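(* Let $p\ge 1$, let $\mu,\beta\in\mathbf{R}^p$, let $A$ be a full-rank $p\times p$ real matrix, let $Z$ be a $p\times 1$ standard normal vector, and let $X$ be a scalar random variable independent of $Z$ having the generalized inverse Gaussian density with parameters $\lambda,\chi,\psi$, $$g(x)=\frac{(\psi/\chi)^{\lambda/2}}{2K_\lambda(\sqrt{\psi\chi})}\,x^{\lambda-1}\exp\left[-\frac12\left(\chi x^{-1}+\psi x\right)\right],\quad x>0,$$ where $K_\lambda$ is the modified Bessel function of the second kind. Let $f(y)$, $y\in\mathbf{R}^p$, denote the density of $Y=\mu+\beta X+\sqrt{X}\,AZ$. Then: (i) The density $f$ has convex contours. (ii) The mode of $f$ is at $\mu$ if and only if $\beta=0$, or $\chi=0$ and $0<\lambda\le(p+1)/2$. (iii) The density $f$ is log-concave if and only if $\lambda\ge(p+1)/2$. (iv) The function $t\mapsto f(\mu+bt)$ is log-convex on $t\in(0,\infty)$ for all nonzero $b\in\mathbf{R}^p$ if and only if $\chi=0$ and $0<\lambda\le(p+1)/2$.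
   Context: The allowable parameters of the generalized inverse Gaussian density are: $\chi\ge0,\ \psi>0$ if $\lambda>0$; $\chi>0,\ \psi>0$ if $\lambda=0$; $\chi>0,\ \psi\ge0$ if $\lambda<0$. In the boundary cases the normalizing constant is understood as a limit: for $\chi=0$ (so $\lambda>0$), $g(x)=\frac{(\psi/2)^\lambda}{\Gamma(\lambda)}x^{\lambda-1}e^{-\psi x/2}$; for $\psi=0$ (so $\lambda<0$), $g(x)=\frac{(\chi/2)^{-\lambda}}{\Gamma(-\lambda)}x^{\lambda-1}e^{-\chi/(2x)}$. The density of $Y$ is taken to be $f(y)=\int_0^\infty(2\pi x)^{-p/2}|\det A|^{-1}\exp\left(-\frac{\|A^{-1}(y-\mu-\beta x)\|^2}{2x}\right)g(x)\,dx$, $y\in\mathbf{R}^p$, where $\|\cdot\|$ is the Euclidean norm; the value $f(\mu)=+\infty$ is allowed. A function $f$ on $\mathbf{R}^p$ has convex contours if the set $\{y\in\mathbf{R}^p: f(y)\ge c\}$ is convex for all $c\in\mathbf{R}$. The mode of $f$ is the point at which $f$ attains its maximum. A nonnegative function $f$ on $\mathbf{R}^p$ is log-concave if $f(\theta x+(1-\theta)y)\ge[f(x)]^\theta[f(y)]^{1-\theta}$ for all $x,y\in\mathbf{R}^p$, $\theta\in(0,1)$. A positive function $h$ on an interval $I$ is log-convex on $I$ if $\log h$ is convex on $I$. *)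

theory Defs
  imports "HOL-Probability.Probability"
begin

text \<open>
  Modified Bessel function of the second kind, for real order and \<open>z > 0\<close>, by its
  standard integral representation (DLMF 10.32.9).
\<close>

definition Bessel_K :: "real \<Rightarrow> real \<Rightarrow> real" where
  "Bessel_K \<nu> z = (LINT t:{0<..}|lborel. exp (- z * cosh t) * cosh (\<nu> * t))"

definition gig_params :: "real \<Rightarrow> real \<Rightarrow> real \<Rightarrow> bool" where
  "gig_params lam chi psi \<longleftrightarrow>
     (lam > 0 \<longrightarrow> chi \<ge> 0 \<and> psi > 0) \<and>
     (lam = 0 \<longrightarrow> chi > 0 \<and> psi > 0) \<and>
     (lam < 0 \<longrightarrow> chi > 0 \<and> psi \<ge> 0)"

text \<open>
  For allowable parameters the boundary case \<open>chi = 0\<close> forces \<open>lam > 0\<close> (gamma density), and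
  \<open>psi = 0\<close> forces \<open>lam < 0\<close> (inverse gamma density); the two do not overlap.
\<close>

definition gig_density :: "real \<Rightarrow> real \<Rightarrow> real \<Rightarrow> real \<Rightarrow> real" where
  "gig_density lam chi psi x =
     (if x \<le> 0 then 0
      else if chi = 0 then
        (psi / 2) powr lam / Gamma lam * x powr (lam - 1) * exp (- psi * x / 2)
      else if psi = 0 then
        (chi / 2) powr (- lam) / Gamma (- lam) * x powr (lam - 1) * exp (- chi / (2 * x))
      else
        (psi / chi) powr (lam / 2) / (2 * Bessel_K lam (sqrt (psi * chi))) * x powr (lam - 1)
          * exp (- (chi / x + psi * x) / 2))"

text \<open>
  The density of \<open>\<mu> + X \<beta> + \<surd>X A Z\<close>, where \<open>X\<close> has density \<open>g\<close> on the positive half-line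
  and \<open>Z\<close> is an independent standard normal vector (see
  \<open>distributed_normal_mixture\<close> below).
  This version is defined pointwise and may be infinite at \<open>\<mu>\<close>.
\<close>

definition normal_mixture_density ::
  "real ^ 'p \<Rightarrow> real ^ 'p \<Rightarrow> real ^ 'p ^ 'p \<Rightarrow> (real \<Rightarrow> real) \<Rightarrow> real ^ 'p \<Rightarrow> ennreal" where
  "normal_mixture_density \<mu> \<beta> A g y =
     (\<integral>\<^sup>+x\<in>{0<..}. ennreal ((2 * pi * x) powr (- (real CARD('p) / 2)) * inverse \<bar>det A\<bar>
        * exp (- ((norm (matrix_inv A *v (y - \<mu> - x *\<^sub>R \<beta>)))\<^sup>2 / (2 * x))) * g x) \<partial>lborel)"

definition std_normal_vec_density :: "real ^ 'p \<Rightarrow> real" where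
  "std_normal_vec_density z = (\<Prod>i\<in>UNIV. std_normal_density (z $ i))"

text \<open>For negative \<open>c\<close>, \<open>ennreal c = 0\<close> and the superlevel set is the whole space, as it should be.\<close>

definition convex_contours :: "('a::real_vector \<Rightarrow> ennreal) \<Rightarrow> bool" where
  "convex_contours f \<longleftrightarrow> (\<forall>c::real. convex {y. ennreal c \<le> f y})"

text \<open>The mode is \<^emph>\<open>the\<close> point of maximum, so uniqueness of the maximizer is included.\<close>

definition is_mode :: "('a \<Rightarrow> ennreal) \<Rightarrow> 'a \<Rightarrow> bool" where
  "is_mode f m \<longleftrightarrow> {y. \<forall>z. f z \<le> f y} = {m}"

text \<open>Real power for a positive exponent, with \<open>\<infinity>\<close> raised to \<open>a\<close> being \<open>\<infinity>\<close>.\<close>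

definition epowr :: "ennreal \<Rightarrow> real \<Rightarrow> ennreal" where
  "epowr u a = (if u = \<infinity> then \<infinity> else ennreal (enn2real u powr a))"

definition log_concave_fun :: "('a::real_vector \<Rightarrow> ennreal) \<Rightarrow> bool" where
  "log_concave_fun f \<longleftrightarrow>
     (\<forall>x y. \<forall>\<theta>\<in>{0<..<1}.
        f (\<theta> *\<^sub>R x + (1 - \<theta>) *\<^sub>R y) \<ge> epowr (f x) \<theta> * epowr (f y) (1 - \<theta>))"

definition log_convex_fun_on :: "real set \<Rightarrow> (real \<Rightarrow> ennreal) \<Rightarrow> bool" where
  "log_convex_fun_on I h \<longleftrightarrow>
     (\<forall>t\<in>I. 0 < h t \<and> h t < \<infinity>) \<and> convex_on I (\<lambda>t. ln (enn2real (h t)))"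

lemma matrix_inv_mult:
  fixes L :: "real ^ 'p ^ 'p"
  assumes "invertible L"
  shows "L ** matrix_inv L = mat 1" and "matrix_inv L ** L = mat 1"
proof -
  have "L ** matrix_inv L = mat 1 \<and> matrix_inv L ** L = mat 1"
    unfolding matrix_inv_def using assms unfolding invertible_def by (rule someI_ex)
  then show "L ** matrix_inv L = mat 1" and "matrix_inv L ** L = mat 1" by auto
qed

lemma det_scaleR_matrix:
  fixes A :: "real ^ 'p ^ 'p"
  shows "det (c *\<^sub>R A) = c ^ CARD('p) * det A"
proof -
  have "c *\<^sub>R A = (\<chi> i. c *s A $ i)"
    by (simp add: vec_eq_iff)
  then show ?thesis
    using det_rows_mul[of "\<lambda>_. c" "\<lambda>i. A $ i"] by simp
qed

text \<open>
  The remaining facts show that \<open>normal_mixture_density\<close> is the density of the random vector.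
  The index type is well-ordered here only because the library proves the change of variables
  formula for linear maps under that restriction. Independence of \<open>X\<close> and \<open>Z\<close> is expressed by
  their joint law, since \<open>indep_var\<close> requires both variables to have the same value type.
\<close>

lemma lborel_affine_matrix:
  fixes L :: "real ^ ('p::{finite,wellorder}) ^ ('p::{finite,wellorder})" and c :: "real ^ ('p::{finite,wellorder})"
  assumes "det L \<noteq> 0"
  shows "lborel = density (distr lborel borel (\<lambda>z. c + L *v z)) (\<lambda>_. ennreal \<bar>det L\<bar>)"
proof (rule lborel_eqI)
  fix l u :: "real ^ ('p::{finite,wellorder})"
  assume lu: "\<And>b. b \<in> Basis \<Longrightarrow> l \<bullet> b \<le> u \<bullet> b"
  define V where "V = matrix_inv L"
  have inv: "invertible L" using assms by (simp add: invertible_det_nz)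
  have LV: "L ** V = mat 1" and VL: "V ** L = mat 1"
    unfolding V_def using matrix_inv_mult[OF inv] by auto
  have LVx: "L *v (V *v x) = x" and VLx: "V *v (L *v x) = x" for x
    by (simp_all add: matrix_vector_mul_assoc LV VL)
  have [measurable]: "(\<lambda>z. c + L *v z) \<in> borel \<rightarrow>\<^sub>M borel"
    by (intro borel_measurable_continuous_onI continuous_intros
          linear_continuous_on matrix_vector_mul_bounded_linear)
  have vim: "(\<lambda>z. c + L *v z) -` box l u = (\<lambda>y. V *v y) ` ((\<lambda>y. - c + y) ` box l u)"
  proof safe
    fix z assume "c + L *v z \<in> box l u"
    then show "z \<in> (\<lambda>y. V *v y) ` ((\<lambda>y. - c + y) ` box l u)"
      by (intro image_eqI[of _ _ "L *v z"] image_eqI[of _ _ "c + L *v z"]) (auto simp: VLx)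
  next
    fix y assume "y \<in> box l u"
    then show "V *v (- c + y) \<in> (\<lambda>z. c + L *v z) -` box l u"
      by (simp add: LVx)
  qed
  have box_meas: "(\<lambda>y. - c + y) ` box l u \<in> lmeasurable"
    by (rule measurable_translation) simp
  have det_V: "\<bar>det V\<bar> * \<bar>det L\<bar> = 1"
    using VL by (metis abs_mult abs_one det_I det_mul)
  have lm: "(\<lambda>y. V *v y) ` ((\<lambda>y. - c + y) ` box l u) \<in> lmeasurable"
    by (rule measurable_linear_image[OF matrix_vector_mul_linear box_meas])
  have m: "measure lebesgue ((\<lambda>y. V *v y) ` ((\<lambda>y. - c + y) ` box l u))
      = \<bar>det V\<bar> * measure lebesgue (box l u)"
    using measure_linear_image[OF matrix_vector_mul_linear box_meas, of V]
      measure_translation[of "- c" "box l u"] by simp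
  have bor: "(\<lambda>z. c + L *v z) -` box l u \<in> sets lborel"
    using measurable_sets[of "\<lambda>z. c + L *v z" borel borel "box l u"] by simp
  have e: "emeasure lborel ((\<lambda>z. c + L *v z) -` box l u)
      = ennreal (\<bar>det V\<bar> * measure lebesgue (box l u))"
  proof -
    have "emeasure lborel ((\<lambda>z. c + L *v z) -` box l u)
        = emeasure lebesgue ((\<lambda>z. c + L *v z) -` box l u)"
      using bor by (simp add: main_part_sets)
    also have "\<dots> = ennreal (measure lebesgue ((\<lambda>z. c + L *v z) -` box l u))"
      using lm unfolding vim by (rule emeasure_eq_measure2)
    finally show ?thesis
      using m unfolding vim by simp
  qed
  have "emeasure (density (distr lborel borel (\<lambda>z. c + L *v z)) (\<lambda>_. ennreal \<bar>det L\<bar>)) (box l u)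
      = ennreal \<bar>det L\<bar> * emeasure lborel ((\<lambda>z. c + L *v z) -` box l u)"
    by (simp add: emeasure_density_const emeasure_distr)
  also have "\<dots> = ennreal (\<bar>det L\<bar> * (\<bar>det V\<bar> * measure lebesgue (box l u)))"
    unfolding e by (simp add: ennreal_mult')
  also have "\<bar>det L\<bar> * (\<bar>det V\<bar> * measure lebesgue (box l u)) = measure lebesgue (box l u)"
    using det_V by (metis mult.assoc mult.commute mult_1)
  also have "ennreal \<dots> = (\<Prod>b\<in>Basis. (u - l) \<bullet> b)"
    using lu by (simp add: measure_completion)
  finally show "emeasure (density (distr lborel borel (\<lambda>z. c + L *v z)) (\<lambda>_. ennreal \<bar>det L\<bar>)) (box l u)
      = ennreal (\<Prod>b\<in>Basis. (u - l) \<bullet> b)" .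
qed simp

lemma nn_integral_affine_matrix:
  fixes L :: "real ^ ('p::{finite,wellorder}) ^ ('p::{finite,wellorder})" and c :: "real ^ ('p::{finite,wellorder})"
  assumes "det L \<noteq> 0" and [measurable]: "F \<in> borel_measurable borel"
  shows "(\<integral>\<^sup>+z. F z \<partial>lborel)
    = (\<integral>\<^sup>+y. ennreal (inverse \<bar>det L\<bar>) * F (matrix_inv L *v (y - c)) \<partial>lborel)"
proof -
  define G where "G = (\<lambda>y. ennreal (inverse \<bar>det L\<bar>) * F (matrix_inv L *v (y - c)))"
  have inv: "invertible L" using assms by (simp add: invertible_det_nz)
  have [measurable]: "(\<lambda>z. c + L *v z) \<in> borel \<rightarrow>\<^sub>M borel"
      "(\<lambda>y. matrix_inv L *v (y - c)) \<in> borel \<rightarrow>\<^sub>M borel"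
    by (intro borel_measurable_continuous_onI continuous_intros
          linear_continuous_on matrix_vector_mul_bounded_linear
          bounded_linear.continuous_on[OF matrix_vector_mul_bounded_linear])+
  have [measurable]: "G \<in> borel_measurable borel" unfolding G_def by measurable
  have "(\<integral>\<^sup>+y. G y \<partial>lborel)
      = (\<integral>\<^sup>+z. ennreal \<bar>det L\<bar> * G (c + L *v z) \<partial>lborel)"
    by (subst lborel_affine_matrix[OF assms(1), of c])
       (simp add: nn_integral_density nn_integral_distr)
  also have "\<dots> = (\<integral>\<^sup>+z. F z \<partial>lborel)"
    using assms(1) matrix_inv_mult(2)[OF inv]
    by (intro nn_integral_cong)
       (simp add: G_def matrix_vector_mul_assoc flip: mult.assoc ennreal_mult')
  finally show ?thesis by (simp add: G_def)
qed

lemma std_normal_vec_density_eq: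
  fixes z :: "real ^ 'p"
  shows "std_normal_vec_density z
    = (2 * pi) powr (- (real CARD('p) / 2)) * exp (- ((norm z)\<^sup>2 / 2))"
proof -
  have "std_normal_vec_density z
      = (\<Prod>i\<in>(UNIV::'p set). (2 * pi) powr (- (1/2))) * (\<Prod>i\<in>(UNIV::'p set). exp (- ((z $ i)\<^sup>2 / 2)))"
    unfolding std_normal_vec_density_def prod.distrib[symmetric]
    by (intro prod.cong) (auto simp: std_normal_density_def powr_minus powr_half_sqrt field_simps)
  also have "(\<Prod>i\<in>(UNIV::'p set). (2 * pi) powr (- (1/2))) = (2 * pi) powr (- (real CARD('p) / 2))"
    by (simp add: powr_powr flip: powr_realpow)
  also have "(\<Prod>i\<in>(UNIV::'p set). exp (- ((z $ i)\<^sup>2 / 2))) = exp (- ((norm z)\<^sup>2 / 2))"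
    by (simp add: norm_vec_def L2_set_def exp_sum[symmetric] sum_negf sum_divide_distrib
          real_sqrt_pow2 sum_nonneg)
  finally show ?thesis .
qed

lemma (in prob_space) distributed_normal_mixture:
  fixes \<mu> \<beta> :: "real ^ ('p::{finite,wellorder})" and A :: "real ^ ('p::{finite,wellorder}) ^ ('p::{finite,wellorder})" and X :: "'a \<Rightarrow> real" and Z :: "'a \<Rightarrow> real ^ ('p::{finite,wellorder})"
  assumes A: "rank A = CARD('p)"
    and g[measurable]: "g \<in> borel_measurable borel"
    and g_nonneg: "\<And>x. 0 \<le> g x" and g_zero: "\<And>x. x \<le> 0 \<Longrightarrow> g x = 0"
    and X: "distributed M lborel X (\<lambda>x. ennreal (g x))"
    and Z: "distributed M lborel Z (\<lambda>z. ennreal (std_normal_vec_density z))"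
    and indep: "distr M lborel X \<Otimes>\<^sub>M distr M lborel Z = distr M (lborel \<Otimes>\<^sub>M lborel) (\<lambda>\<omega>. (X \<omega>, Z \<omega>))"
  shows "distributed M lborel (\<lambda>\<omega>. \<mu> + X \<omega> *\<^sub>R \<beta> + sqrt (X \<omega>) *\<^sub>R (A *v Z \<omega>))
           (normal_mixture_density \<mu> \<beta> A g)"
proof -
  have inv: "invertible A"
    using A by (metis full_rank_injective invertible_left_inverse
        matrix_left_invertible_injective)
  have dA: "det A \<noteq> 0" using inv by (simp add: invertible_det_nz)
  define T where "T = (\<lambda>(x, z). \<mu> + x *\<^sub>R \<beta> + sqrt x *\<^sub>R (A *v z))"
  define \<phi> :: "real ^ ('p::{finite,wellorder}) \<Rightarrow> real" where "\<phi> = std_normal_vec_density"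
  define k where "k = (\<lambda>(x, y). (2 * pi * x) powr (- (real CARD('p) / 2)) * inverse \<bar>det A\<bar>
        * exp (- ((norm (matrix_inv A *v (y - \<mu> - x *\<^sub>R \<beta>)))\<^sup>2 / (2 * x))) * g x)"
  have mv[measurable]: "(\<lambda>y. V *v y) \<in> borel \<rightarrow>\<^sub>M borel" for V :: "real ^ ('p::{finite,wellorder}) ^ ('p::{finite,wellorder})"
    by (intro borel_measurable_continuous_onI linear_continuous_on matrix_vector_mul_bounded_linear)
  have [measurable]: "\<phi> \<in> borel_measurable borel"
    unfolding \<phi>_def std_normal_vec_density_eq[abs_def] by measurable
  have T_meas[measurable]: "T \<in> lborel \<Otimes>\<^sub>M lborel \<rightarrow>\<^sub>M borel"
    unfolding T_def by measurable
  have k_meas[measurable]: "k \<in> borel_measurable (lborel \<Otimes>\<^sub>M lborel)"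
    unfolding k_def by measurable
  have mix: "normal_mixture_density \<mu> \<beta> A g y
      = (\<integral>\<^sup>+x. ennreal (k (x, y)) * indicator {0<..} x \<partial>lborel)" for y
    unfolding normal_mixture_density_def k_def by simp
  have mix_meas[measurable]: "normal_mixture_density \<mu> \<beta> A g \<in> borel_measurable lborel"
    unfolding mix[abs_def] by measurable
  have joint: "distributed M (lborel \<Otimes>\<^sub>M lborel) (\<lambda>\<omega>. (X \<omega>, Z \<omega>)) (\<lambda>(x, z). ennreal (g x) * ennreal (\<phi> z))"
    using distributed_joint_indep'[OF sigma_finite_lborel sigma_finite_lborel X Z indep]
    by (simp add: \<phi>_def)
  note XZ[measurable] = distributed_measurable[OF joint]
  have inner: "(\<integral>\<^sup>+z. ennreal (g x) * ennreal (\<phi> z) * indicator B (T (x, z)) \<partial>lborel)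
      = (\<integral>\<^sup>+y. ennreal (k (x, y)) * indicator {0<..} x * indicator B y \<partial>lborel)"
    if [measurable]: "B \<in> sets borel" for x B
  proof (cases "x > 0")
    case False
    then show ?thesis using g_zero[of x] by simp
  next
    case True
    define L where "L = sqrt x *\<^sub>R A"
    have Lv: "L *v z = sqrt x *\<^sub>R (A *v z)" for z
      unfolding L_def by (simp add: scaleR_matrix_vector_assoc)
    have dL: "det L = sqrt x ^ CARD('p) * det A"
      unfolding L_def by (rule det_scaleR_matrix)
    have dL0: "det L \<noteq> 0" using dA True by (simp add: dL)
    have iL: "matrix_inv L *v w = inverse (sqrt x) *\<^sub>R (matrix_inv A *v w)" for w
    proof -
      have iL: "invertible L" using dL0 by (simp add: invertible_det_nz)
      have "L *v (inverse (sqrt x) *\<^sub>R (matrix_inv A *v w)) = w"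
        using True matrix_inv_mult(1)[OF inv]
        unfolding Lv by (simp add: matrix_vector_mult_scaleR matrix_vector_mul_assoc)
      then have "matrix_inv L *v (L *v (inverse (sqrt x) *\<^sub>R (matrix_inv A *v w))) = matrix_inv L *v w"
        by simp
      then show ?thesis using matrix_inv_mult(2)[OF iL] by (simp add: matrix_vector_mul_assoc)
    qed
    have "(\<integral>\<^sup>+z. ennreal (g x) * ennreal (\<phi> z) * indicator B (T (x, z)) \<partial>lborel)
      = (\<integral>\<^sup>+y. ennreal (inverse \<bar>det L\<bar>) * (ennreal (g x) * ennreal (\<phi> (matrix_inv L *v (y - (\<mu> + x *\<^sub>R \<beta>))))
           * indicator B (T (x, matrix_inv L *v (y - (\<mu> + x *\<^sub>R \<beta>))))) \<partial>lborel)"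
    proof (rule nn_integral_affine_matrix[OF dL0,
          of "\<lambda>z. ennreal (g x) * ennreal (\<phi> z) * indicator B (T (x, z))" "\<mu> + x *\<^sub>R \<beta>"])
      show "(\<lambda>z. ennreal (g x) * ennreal (\<phi> z) * indicator B (T (x, z))) \<in> borel_measurable borel"
        unfolding T_def prod.case by measurable
    qed
    also have "\<dots> = (\<integral>\<^sup>+y. ennreal (k (x, y)) * indicator {0<..} x * indicator B y \<partial>lborel)"
    proof (intro nn_integral_cong)
      fix y :: "real ^ ('p::{finite,wellorder})"
      let ?w = "y - (\<mu> + x *\<^sub>R \<beta>)"
      have TB: "T (x, matrix_inv L *v ?w) = y"
        using True matrix_inv_mult(1)[OF inv]
        by (simp add: T_def iL matrix_vector_mult_scaleR matrix_vector_mul_assoc)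
      have n: "(norm (matrix_inv L *v ?w))\<^sup>2 / 2 = (norm (matrix_inv A *v (y - \<mu> - x *\<^sub>R \<beta>)))\<^sup>2 / (2 * x)"
        using True by (simp add: iL power_mult_distrib field_simps diff_diff_eq)
      have p: "inverse \<bar>det L\<bar> * (2 * pi) powr (- (real CARD('p) / 2))
          = (2 * pi * x) powr (- (real CARD('p) / 2)) * inverse \<bar>det A\<bar>"
      proof -
        have "sqrt x ^ CARD('p) = x powr (real CARD('p) / 2)"
          using True by (simp add: powr_half_sqrt[symmetric] powr_powr flip: powr_realpow)
        then show ?thesis
          using True by (simp add: dL abs_mult powr_mult powr_minus field_simps)
      qed
      have "inverse \<bar>det L\<bar> * (g x * \<phi> (matrix_inv L *v ?w)) = k (x, y)"
        unfolding \<phi>_def std_normal_vec_density_eq n k_def prod.case p[symmetric] by simp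
      moreover have "0 \<le> \<phi> (matrix_inv L *v ?w)"
        unfolding \<phi>_def std_normal_vec_density_eq by simp
      ultimately have "ennreal (inverse \<bar>det L\<bar>) * (ennreal (g x) * ennreal (\<phi> (matrix_inv L *v ?w)))
          = ennreal (k (x, y))"
        using g_nonneg[of x] by (simp add: ennreal_mult[symmetric])
      then show "ennreal (inverse \<bar>det L\<bar>) * (ennreal (g x) * ennreal (\<phi> (matrix_inv L *v ?w))
           * indicator B (T (x, matrix_inv L *v ?w)))
          = ennreal (k (x, y)) * indicator {0<..} x * indicator B y"
        using True unfolding TB by (simp add: mult.assoc[symmetric])
    qed
    finally show ?thesis .
  qed
  show ?thesis
    unfolding distributed_def
  proof (intro conjI)
    have Ym: "(\<lambda>\<omega>. T (X \<omega>, Z \<omega>)) \<in> M \<rightarrow>\<^sub>M lborel"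
      using measurable_compose[OF XZ T_meas] by simp
    then show "(\<lambda>\<omega>. \<mu> + X \<omega> *\<^sub>R \<beta> + sqrt (X \<omega>) *\<^sub>R (A *v Z \<omega>)) \<in> M \<rightarrow>\<^sub>M lborel"
      by (simp add: T_def)
    show "distr M lborel (\<lambda>\<omega>. \<mu> + X \<omega> *\<^sub>R \<beta> + sqrt (X \<omega>) *\<^sub>R (A *v Z \<omega>))
        = density lborel (normal_mixture_density \<mu> \<beta> A g)"
    proof (rule measure_eqI)
      fix B assume "B \<in> sets (distr M lborel (\<lambda>\<omega>. \<mu> + X \<omega> *\<^sub>R \<beta> + sqrt (X \<omega>) *\<^sub>R (A *v Z \<omega>)))"
      then have B[measurable]: "B \<in> sets borel" by simp
      have "emeasure (distr M lborel (\<lambda>\<omega>. T (X \<omega>, Z \<omega>))) B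
          = (\<integral>\<^sup>+\<omega>. indicator B (T (X \<omega>, Z \<omega>)) \<partial>M)"
        using nn_integral_distr[OF Ym, of "indicator B"]
          nn_integral_indicator[of B "distr M lborel (\<lambda>\<omega>. T (X \<omega>, Z \<omega>))"] B by simp
      also have "\<dots> = (\<integral>\<^sup>+p. (case p of (x, z) \<Rightarrow> ennreal (g x) * ennreal (\<phi> z)) * indicator B (T p) \<partial>(lborel \<Otimes>\<^sub>M lborel))"
        by (rule distributed_nn_integral[OF joint, symmetric]) measurable
      also have "\<dots> = (\<integral>\<^sup>+x. \<integral>\<^sup>+z. ennreal (g x) * ennreal (\<phi> z) * indicator B (T (x, z)) \<partial>lborel \<partial>lborel)"
        by (subst lborel.nn_integral_fst[symmetric]) auto
      also have "\<dots> = (\<integral>\<^sup>+x. \<integral>\<^sup>+y. ennreal (k (x, y)) * indicator {0<..} x * indicator B y \<partial>lborel \<partial>lborel)"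
        by (simp add: inner)
      also have "\<dots> = (\<integral>\<^sup>+y. \<integral>\<^sup>+x. ennreal (k (x, y)) * indicator {0<..} x * indicator B y \<partial>lborel \<partial>lborel)"
        by (rule lborel_pair.Fubini'[symmetric]) measurable
      also have "\<dots> = (\<integral>\<^sup>+y. normal_mixture_density \<mu> \<beta> A g y * indicator B y \<partial>lborel)"
        unfolding mix by (intro nn_integral_cong nn_integral_multc) measurable
      also have "\<dots> = emeasure (density lborel (normal_mixture_density \<mu> \<beta> A g)) B"
        by (rule emeasure_density[symmetric]) auto
      finally show "emeasure (distr M lborel (\<lambda>\<omega>. \<mu> + X \<omega> *\<^sub>R \<beta> + sqrt (X \<omega>) *\<^sub>R (A *v Z \<omega>))) B
        = emeasure (density lborel (normal_mixture_density \<mu> \<beta> A g)) B"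
        by (simp add: T_def)
    qed simp
  qed (rule mix_meas)
qed

lemma Bessel_K_nonneg: "0 \<le> Bessel_K \<nu> z"
  unfolding Bessel_K_def set_lebesgue_integral_def
  by (intro Bochner_Integration.integral_nonneg) simp

lemma gig_density_nonneg:
  assumes "gig_params lam chi psi"
  shows "0 \<le> gig_density lam chi psi x"
proof -
  have "chi = 0 \<Longrightarrow> 0 < lam" and "psi = 0 \<Longrightarrow> lam < 0" and "0 \<le> chi" and "0 \<le> psi"
    using assms by (cases lam "0::real" rule: linorder_cases; simp add: gig_params_def)+
  then show ?thesis
    using Gamma_real_pos[of lam] Gamma_real_pos[of "- lam"]
    by (simp add: gig_density_def Bessel_K_nonneg)
qed

lemma gig_density_measurable [measurable]:
  "gig_density lam chi psi \<in> borel_measurable borel"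
  unfolding gig_density_def[abs_def] by measurable

lemma (in prob_space) distributed_generalized_hyperbolic:
  fixes \<mu> \<beta> :: "real ^ ('p::{finite,wellorder})"
    and A :: "real ^ ('p::{finite,wellorder}) ^ ('p::{finite,wellorder})"
    and X :: "'a \<Rightarrow> real" and Z :: "'a \<Rightarrow> real ^ ('p::{finite,wellorder})"
  assumes "rank A = CARD('p)" and "gig_params lam chi psi"
    and "distributed M lborel X (\<lambda>x. ennreal (gig_density lam chi psi x))"
    and "distributed M lborel Z (\<lambda>z. ennreal (std_normal_vec_density z))"
    and "distr M lborel X \<Otimes>\<^sub>M distr M lborel Z = distr M (lborel \<Otimes>\<^sub>M lborel) (\<lambda>\<omega>. (X \<omega>, Z \<omega>))"
  shows "distributed M lborel (\<lambda>\<omega>. \<mu> + X \<omega> *\<^sub>R \<beta> + sqrt (X \<omega>) *\<^sub>R (A *v Z \<omega>))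
           (normal_mixture_density \<mu> \<beta> A (gig_density lam chi psi))"
  by (rule distributed_normal_mixture[OF assms(1) gig_density_measurable
        gig_density_nonneg[OF assms(2)] _ assms(3-5)])
     (simp add: gig_density_def)

end

theory Submission
  imports Defs "HOL-Real_Asymp.Real_Asymp"
begin

text \<open>
  Put \<open>u = A\<^sup>-\<^sup>1(y - \<mu>)\<close>, \<open>\<gamma> = A\<^sup>-\<^sup>1\<beta>\<close>, \<open>\<nu> = \<lambda> - p/2\<close> and \<open>a = \<psi> + |\<gamma>|\<^sup>2\<close>. Then \<open>f(y)\<close> is a constant multiple of
  \<open>exp(u \<bullet> \<gamma>) G(\<chi> + |u|\<^sup>2)\<close> with \<open>G(s) = \<integral> x^(\<nu> - 1) exp(-(s/x + a x)/2) dx\<close>. The logarithmic slope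
  \<open>y(r) = - d/dr log G(r\<^sup>2)\<close> satisfies the Riccati equation \<open>y' = y\<^sup>2 - a + (2\<nu> - 1) y/r\<close>.
  A positive solution on the half-line cannot have a derivative of the wrong sign: once it had,
  the equation would preserve that sign and drive \<open>y\<close> below \<open>0\<close> or to infinity. Hence \<open>y\<close> increases if
  \<open>\<nu> \<ge> 1/2\<close> and decreases to \<open>\<surd>a \<ge> |\<gamma>|\<close> if \<open>\<nu> \<le> 1/2\<close>, which yields (ii)-(iv), and (i) for
  \<open>\<nu> \<ge> 1/2\<close>. For \<open>\<nu> < 1/2\<close> a further comparison argument bounds the slope of \<open>\<surd>a r / y(r)\<close> by \<open>1\<close>;
  this makes the second derivative of \<open>log f\<close> along a line negative at every critical point, and so
  \<open>f\<close> is quasi-concave when \<open>\<chi> > 0\<close>. The case \<open>\<chi> = 0\<close>, where \<open>f\<close> may be singular at \<open>\<mu>\<close>, follows by monotone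
  convergence as \<open>\<chi>\<close> decreases to \<open>0\<close>.
\<close>

section \<open>The generalized inverse Gaussian integral\<close>

lemma exp_minus_le_power:
  fixes w :: real
  assumes "0 < w"
  shows "exp (- w) \<le> (real N / w) ^ N"
proof (cases "N = 0")
  case False
  \<comment> \<open>The inequality \<open>z <= exp z\<close> at \<open>z = w / real N\<close> is
    raised to the power \<open>N\<close>. Since \<open>N\<close> is free, the exponential can absorb
    any power of \<open>w\<close>.\<close>
  have "w / real N \<le> exp (w / real N)"
    using exp_ge_add_one_self[of "w / real N"] by linarith
  then have "(w / real N) ^ N \<le> exp (w / real N) ^ N"
    using assms by (intro power_mono) auto
  also have "exp (w / real N) ^ N = exp w"
    using False by (simp add: exp_of_nat_mult[symmetric])
  finally have "inverse (exp w) \<le> inverse ((w / real N) ^ N)"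
    using assms False by (intro le_imp_inverse_le) auto
  then show ?thesis
    by (simp add: exp_minus power_inverse[symmetric])
qed (use assms in simp)

text \<open>A vanishing integral would force \<open>f\<close> to vanish almost everywhere, yet
  \<open>{0<..1}\<close> has positive measure.\<close>

lemma set_integral_pos:
  fixes f :: "real \<Rightarrow> real"
  assumes "set_integrable lborel {0<..} f" and "\<And>x. 0 < x \<Longrightarrow> 0 < f x"
  shows "0 < (LINT x:{0<..}|lborel. f x)"
proof -
  let ?g = "\<lambda>x. indicator {0<..} x *\<^sub>R f x"
  have g: "integrable lborel ?g" "AE x in lborel. 0 \<le> ?g x"
    using assms by (auto simp: set_integrable_def indicator_def less_imp_le)
  have "integral\<^sup>L lborel ?g \<noteq> 0"
  proof
    assume "integral\<^sup>L lborel ?g = 0"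
    then have "AE x in lborel. ?g x = 0"
      using integral_nonneg_eq_0_iff_AE[OF g] by simp
    then have "AE x in lborel. x \<notin> {0<..1::real}"
      by eventually_elim (use assms(2) in \<open>force simp: indicator_def split: if_splits\<close>)
    then have "emeasure lborel {0<..1::real} = 0"
      by (subst (asm) AE_iff_measurable[where N = "{0<..1}"]) auto
    then show False by simp
  qed
  then show ?thesis
    using integral_nonneg_AE[OF g(2)] by (simp add: set_lebesgue_integral_def)
qed

lemma set_integrable_powr_from_0:
  fixes \<kappa> :: real
  assumes "-1 < \<kappa>"
  shows "set_integrable lborel {0<..1} (\<lambda>x. x powr \<kappa>)"
proof -
  have "(\<lambda>x. x powr \<kappa>) absolutely_integrable_on {0..1}"
    using has_integral_powr_from_0[OF assms, of 1]
    by (intro nonnegative_absolutely_integrable_1) (auto simp: integrable_on_def)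
  then have "set_integrable lborel {0..1} (\<lambda>x. x powr \<kappa>)"
    by (simp add: set_integrable_def integrable_completion)
  then show ?thesis by (rule set_integrable_subset) auto
qed

lemma set_integrable_powr_to_inf:
  fixes \<kappa> :: real
  assumes "\<kappa> < -1"
  shows "set_integrable lborel {1<..} (\<lambda>x. x powr \<kappa>)"
proof -
  have "(\<lambda>x. x powr \<kappa>) absolutely_integrable_on {1..}"
    using has_integral_powr_to_inf[OF assms, of 1]
    by (intro nonnegative_absolutely_integrable_1) (auto simp: integrable_on_def)
  then have "set_integrable lborel {1..} (\<lambda>x. x powr \<kappa>)"
    by (simp add: set_integrable_def integrable_completion)
  then show ?thesis by (rule set_integrable_subset) auto
qed

definition gig_kernel :: "real \<Rightarrow> real \<Rightarrow> real \<Rightarrow> real \<Rightarrow> real" where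
  "gig_kernel a \<nu> s x = x powr (\<nu> - 1) * exp (- (s / x + a * x) / 2)"

text \<open>For positive \<open>a\<close> and \<open>s\<close> this is 2 (s/a)^(\<nu>/2)
  K_\<nu>(sqrt(a s)), with K the modified Bessel function. The integral form also makes sense at
  \<open>s = 0\<close> or \<open>a = 0\<close> when it converges.\<close>

definition gig_int :: "real \<Rightarrow> real \<Rightarrow> real \<Rightarrow> real" where
  "gig_int a \<nu> s = (LINT x:{0<..}|lborel. gig_kernel a \<nu> s x)"

text \<open>Extended-valued, because at \<open>s = 0\<close> with \<open>\<nu> <= 0\<close> the
  integral diverges and the Bochner integral \<open>gig_int\<close> would default to
  \<open>0\<close>.\<close>

definition gig_nn :: "real \<Rightarrow> real \<Rightarrow> real \<Rightarrow> ennreal" where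
  "gig_nn a \<nu> s = (\<integral>\<^sup>+x\<in>{0<..}. ennreal (gig_kernel a \<nu> s x) \<partial>lborel)"

lemma gig_kernel_measurable [measurable]: "gig_kernel a \<nu> s \<in> borel_measurable borel"
  unfolding gig_kernel_def[abs_def] by measurable

lemma gig_kernel_pos: "0 < x \<Longrightarrow> 0 < gig_kernel a \<nu> s x"
  by (simp add: gig_kernel_def)

lemma gig_kernel_shift:
  assumes "0 < x"
  shows "gig_kernel a (\<nu> - 1) s x = gig_kernel a \<nu> s x / x"
  using assms by (simp add: gig_kernel_def powr_diff powr_minus field_simps power2_eq_square)

text \<open>Each alternative controls one end of the half-line: \<open>0 < s\<close> or
  \<open>0 < \<nu>\<close> the end at 0, \<open>0 < a\<close> or \<open>\<nu> < 0\<close> the end at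
  infinity. Where the power alone is not known to be integrable, the exponential supplies further
  powers of \<open>x\<close>.\<close>

lemma gig_kernel_integrable:
  assumes "0 \<le> s" "0 \<le> a" and s: "0 < s \<or> 0 < \<nu>" and a: "0 < a \<or> \<nu> < 0"
  shows "set_integrable lborel {0<..} (gig_kernel a \<nu> s)"
proof -
  have kb: "gig_kernel a \<nu> s x \<le> 1 * x powr (\<nu> - 1)" if "0 < x" for x
  proof -
    have "0 \<le> s / x + a * x" using that assms by simp
    then show ?thesis by (simp add: gig_kernel_def mult_left_le)
  qed
  have k0: "\<exists>C \<mu>. 0 < \<mu> \<and> (\<forall>x\<in>{0<..1}. gig_kernel a \<nu> s x \<le> C * x powr (\<mu> - 1))"
  proof (cases "0 < \<nu>")
    case True
    then show ?thesis using kb by (metis greaterThanAtMost_iff)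
  next
    case False
    with s have s0: "0 < s" by simp
    \<comment> \<open>\<open>N\<close> is large enough to push the exponent
      \<open>\<nu> + N - 1\<close> above \<open>-1\<close>.\<close>
    obtain N :: nat where N: "- \<nu> < N" using reals_Archimedean2 by blast
    have "gig_kernel a \<nu> s x \<le> (2 * N / s) ^ N * x powr (\<nu> + N - 1)" if "0 < x" for x
    proof -
      have "exp (- (s / x + a * x) / 2) \<le> exp (- (s / (2 * x)))"
        using that \<open>0 \<le> a\<close> by (simp add: field_simps)
      also have "\<dots> \<le> (N / (s / (2 * x))) ^ N"
        using s0 that by (intro exp_minus_le_power) simp
      also have "\<dots> = (2 * N / s) ^ N * x powr N"
        using that by (simp add: power_mult_distrib power_divide powr_realpow)
      finally have "x powr (\<nu> - 1) * exp (- (s / x + a * x) / 2)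
          \<le> x powr (\<nu> - 1) * ((2 * N / s) ^ N * x powr N)"
        by (intro mult_left_mono) auto
      also have "\<dots> = (2 * N / s) ^ N * x powr (\<nu> + N - 1)"
        by (simp add: powr_add[symmetric] algebra_simps)
      finally show ?thesis by (simp add: gig_kernel_def)
    qed
    with N show ?thesis by (intro exI[of _ "(2 * N / s) ^ N"] exI[of _ "\<nu> + N"]) auto
  qed
  have k1: "\<exists>C \<mu>. 0 < \<mu> \<and> (\<forall>x\<in>{1<..}. gig_kernel a \<nu> s x \<le> C * x powr (- \<mu> - 1))"
  proof (cases "\<nu> < 0")
    case True
    then show ?thesis using kb by (intro exI[of _ 1] exI[of _ "- \<nu>"]) auto
  next
    case False
    with a have a0: "0 < a" by simp
    obtain N :: nat where N: "\<nu> < N" using reals_Archimedean2 by blast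
    have "gig_kernel a \<nu> s x \<le> (2 * N / a) ^ N * x powr (- (N - \<nu>) - 1)" if "0 < x" for x
    proof -
      have "exp (- (s / x + a * x) / 2) \<le> exp (- (a * x / 2))"
        using that \<open>0 \<le> s\<close> by (simp add: field_simps)
      also have "\<dots> \<le> (N / (a * x / 2)) ^ N"
        using a0 that by (intro exp_minus_le_power) simp
      also have "\<dots> = (2 * N / a) ^ N * x powr (- N)"
        using that by (simp add: power_mult_distrib power_divide powr_minus powr_realpow field_simps)
      finally have "x powr (\<nu> - 1) * exp (- (s / x + a * x) / 2)
          \<le> x powr (\<nu> - 1) * ((2 * N / a) ^ N * x powr (- N))"
        by (intro mult_left_mono) auto
      also have "\<dots> = (2 * N / a) ^ N * x powr (- (N - \<nu>) - 1)"
        by (simp add: powr_add[symmetric] algebra_simps)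
      finally show ?thesis by (simp add: gig_kernel_def)
    qed
    with N show ?thesis by (intro exI[of _ "(2 * N / a) ^ N"] exI[of _ "N - \<nu>"]) auto
  qed
  have meas: "set_borel_measurable lborel S (gig_kernel a \<nu> s)" if "S \<in> sets borel" for S
    using that unfolding set_borel_measurable_def by measurable
  obtain C \<mu> where C: "0 < \<mu>" "\<And>x. x \<in> {0<..1} \<Longrightarrow> gig_kernel a \<nu> s x \<le> C * x powr (\<mu> - 1)"
    using k0 by blast
  obtain D \<kappa> where D: "0 < \<kappa>" "\<And>x. x \<in> {1<..} \<Longrightarrow> gig_kernel a \<nu> s x \<le> D * x powr (- \<kappa> - 1)"
    using k1 by blast
  have "set_integrable lborel {0<..1} (gig_kernel a \<nu> s)"
  proof (rule set_integrable_bound[OF set_integrable_mult_right[OF set_integrable_powr_from_0]])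
    show "AE x in lborel. x \<in> {0<..1} \<longrightarrow> norm (gig_kernel a \<nu> s x) \<le> norm (C * x powr (\<mu> - 1))"
      using C gig_kernel_pos by (force intro!: AE_I2 simp: abs_of_pos intro: order_trans[OF _ abs_ge_self])
  qed (use C meas in auto)
  moreover have "set_integrable lborel {1<..} (gig_kernel a \<nu> s)"
  proof (rule set_integrable_bound[OF set_integrable_mult_right[OF set_integrable_powr_to_inf]])
    show "AE x in lborel. x \<in> {1<..} \<longrightarrow> norm (gig_kernel a \<nu> s x) \<le> norm (D * x powr (- \<kappa> - 1))"
      using D gig_kernel_pos by (force intro!: AE_I2 simp: abs_of_pos intro: order_trans[OF _ abs_ge_self])
  qed (use D meas in auto)
  ultimately have "set_integrable lborel ({0<..1} \<union> {1<..}) (gig_kernel a \<nu> s)"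
    by (rule set_integrable_Un) auto
  moreover have "{0<..1} \<union> {1<..} = {0::real<..}" by auto
  ultimately show ?thesis by simp
qed

lemma gig_int_pos:
  assumes "0 \<le> s" "0 \<le> a" "0 < s \<or> 0 < \<nu>" "0 < a \<or> \<nu> < 0"
  shows "0 < gig_int a \<nu> s"
  unfolding gig_int_def
  by (rule set_integral_pos[OF gig_kernel_integrable[OF assms] gig_kernel_pos])

lemma gig_nn_eq:
  assumes "0 \<le> s" "0 \<le> a" "0 < s \<or> 0 < \<nu>" "0 < a \<or> \<nu> < 0"
  shows "gig_nn a \<nu> s = ennreal (gig_int a \<nu> s)"
proof -
  have "gig_nn a \<nu> s = (\<integral>\<^sup>+x. ennreal (indicator {0<..} x *\<^sub>R gig_kernel a \<nu> s x) \<partial>lborel)"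
    unfolding gig_nn_def by (intro nn_integral_cong) (auto split: split_indicator)
  also have "\<dots> = ennreal (LINT x|lborel. indicator {0<..} x *\<^sub>R gig_kernel a \<nu> s x)"
    using gig_kernel_integrable[OF assms] gig_kernel_pos
    by (intro nn_integral_eq_integral AE_I2)
       (auto simp: set_integrable_def indicator_def less_imp_le)
  finally show ?thesis by (simp add: gig_int_def set_lebesgue_integral_def)
qed

lemma gig_kernel_antimono: "0 < x \<Longrightarrow> s \<le> s' \<Longrightarrow> gig_kernel a \<nu> s' x \<le> gig_kernel a \<nu> s x"
  by (simp add: gig_kernel_def divide_right_mono)

lemma gig_nn_antimono: "s \<le> s' \<Longrightarrow> gig_nn a \<nu> s' \<le> gig_nn a \<nu> s"
  unfolding gig_nn_def
  by (intro nn_integral_mono) (auto intro!: ennreal_leI gig_kernel_antimono split: split_indicator)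

text \<open>Monotone convergence: the kernel increases as \<open>s\<close> decreases. The limit may
  be infinite, which later gives access to \<open>chi = 0\<close> at the singular point.\<close>

lemma gig_nn_tendsto: "(\<lambda>n. gig_nn a \<nu> (s + 1 / real (Suc n))) \<longlonglongrightarrow> gig_nn a \<nu> s"
  unfolding gig_nn_def
proof (rule nn_integral_LIMSEQ)
  show "incseq (\<lambda>n x. ennreal (gig_kernel a \<nu> (s + 1 / real (Suc n)) x) * indicator {0<..} x)"
    by (auto simp: incseq_def le_fun_def indicator_def frac_le intro!: ennreal_leI gig_kernel_antimono)
  fix x :: real
  have "(\<lambda>n. 1 / real (Suc n)) \<longlonglongrightarrow> 0"
    using LIMSEQ_inverse_real_of_nat by (simp add: inverse_eq_divide)
  then have "(\<lambda>n. gig_kernel a \<nu> (s + 1 / real (Suc n)) x) \<longlonglongrightarrow> gig_kernel a \<nu> (s + 0) x" if "0 < x"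
    unfolding gig_kernel_def using that by (intro tendsto_intros) auto
  then show "(\<lambda>n. ennreal (gig_kernel a \<nu> (s + 1 / real (Suc n)) x) * indicator {0<..} x)
      \<longlonglongrightarrow> ennreal (gig_kernel a \<nu> s x) * indicator {0<..} x"
    by (cases "0 < x") (auto simp: indicator_def intro!: tendsto_ennrealI)
qed auto

section \<open>Differentiation in \<open>s\<close> under the integral sign\<close>

lemma exp_minus_diff_le:
  fixes p q :: real
  shows "\<bar>exp (- p) - exp (- q)\<bar> \<le> \<bar>q - p\<bar> * exp (- min p q)"
proof -
  have le: "exp (- p) - exp (- q) \<le> (q - p) * exp (- p)" for p q :: real
  proof -
    have "exp (- p) * (1 + (p - q)) \<le> exp (- p) * exp (p - q)"
      by (intro mult_left_mono) auto
    then show ?thesis by (simp add: exp_add[symmetric] algebra_simps)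
  qed
  show ?thesis
    using le[of p q] le[of q p] by (cases "p \<le> q") (auto simp: min_def abs_if)
qed

text \<open>A majorant for the difference quotients in \<open>s\<close>, uniform in
  \<open>t >= r\<close>. Differentiating exp(-s/(2x)) in \<open>s\<close> costs a factor 1/x, hence
  the order \<open>\<nu> - 1\<close>.\<close>

lemma gig_kernel_lipschitz:
  assumes "0 < x" "r \<le> s" "r \<le> t"
  shows "\<bar>gig_kernel a \<nu> t x - gig_kernel a \<nu> s x\<bar> \<le> \<bar>t - s\<bar> * (gig_kernel a (\<nu> - 1) r x / 2)"
proof -
  define P where "P = x powr (\<nu> - 1) * exp (- (a * x / 2))"
  have eq: "gig_kernel a \<nu> u x = P * exp (- (u / (2 * x)))" for u
    using assms by (simp add: P_def gig_kernel_def mult.assoc exp_add[symmetric] add_divide_distrib)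
  have "\<bar>exp (- (t / (2 * x))) - exp (- (s / (2 * x)))\<bar>
      \<le> \<bar>s / (2 * x) - t / (2 * x)\<bar> * exp (- min (t / (2 * x)) (s / (2 * x)))"
    by (rule exp_minus_diff_le)
  also have "\<dots> \<le> \<bar>s / (2 * x) - t / (2 * x)\<bar> * exp (- (r / (2 * x)))"
    using assms by (intro mult_left_mono) (auto simp: divide_right_mono)
  also have "\<bar>s / (2 * x) - t / (2 * x)\<bar> = \<bar>t - s\<bar> / (2 * x)"
    using assms by (simp add: diff_divide_distrib[symmetric] abs_minus_commute)
  finally have "P * \<bar>exp (- (t / (2 * x))) - exp (- (s / (2 * x)))\<bar>
      \<le> P * (\<bar>t - s\<bar> / (2 * x) * exp (- (r / (2 * x))))"
    by (intro mult_left_mono) (auto simp: P_def)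
  moreover have "\<bar>gig_kernel a \<nu> t x - gig_kernel a \<nu> s x\<bar> = P * \<bar>exp (- (t / (2 * x))) - exp (- (s / (2 * x)))\<bar>"
    by (simp add: eq right_diff_distrib[symmetric] abs_mult) (simp add: P_def)
  ultimately show ?thesis
    using assms by (simp add: gig_kernel_shift eq mult_ac)
qed

lemma gig_int_has_derivative:
  assumes s: "0 < s" and a0: "0 \<le> a" and a: "0 < a \<or> \<nu> < 0"
  shows "(gig_int a \<nu> has_real_derivative - gig_int a (\<nu> - 1) s / 2) (at s)"
  unfolding has_field_derivative_iff tendsto_at_iff_sequentially
proof (intro allI impI)
  fix X :: "nat \<Rightarrow> real"
  assume X: "\<forall>i. X i \<in> UNIV - {s}" "X \<longlonglongrightarrow> s"
  \<comment> \<open>Once the first \<open>N\<close> terms are dropped, the sequence stays above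
    \<open>s / 2\<close>, so the kernel at \<open>s / 2 > 0\<close> is an integrable majorant for
    dominated convergence.\<close>
  have "eventually (\<lambda>i. s / 2 < X i) sequentially"
    using X(2) s by (intro order_tendstoD) auto
  then obtain N where N: "\<And>i. s / 2 < X (i + N)"
    unfolding eventually_sequentially by (metis le_add2)
  define q where "q i x = indicator {0<..} x *\<^sub>R ((gig_kernel a \<nu> (X (i + N)) x - gig_kernel a \<nu> s x) / (X (i + N) - s))" for i x
  have int: "set_integrable lborel {0<..} (gig_kernel a \<nu> t)" if "0 < t" for t
    using that a a0 by (intro gig_kernel_integrable) auto
  have pos: "0 < X (i + N)" for i using N[of i] s by linarith
  have eq: "((\<lambda>y. (gig_int a \<nu> y - gig_int a \<nu> s) / (y - s)) \<circ> X) (i + N) = integral\<^sup>L lborel (q i)" for i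
  proof -
    have "integral\<^sup>L lborel (q i) = (LINT x:{0<..}|lborel. (gig_kernel a \<nu> (X (i + N)) x - gig_kernel a \<nu> s x) / (X (i + N) - s))"
      unfolding q_def set_lebesgue_integral_def ..
    also have "\<dots> = (gig_int a \<nu> (X (i + N)) - gig_int a \<nu> s) / (X (i + N) - s)"
      unfolding gig_int_def using int[OF pos] int[OF s]
      by (simp add: set_integral_diff)
    finally show ?thesis by simp
  qed
  have "(\<lambda>i. integral\<^sup>L lborel (q i))
      \<longlonglongrightarrow> integral\<^sup>L lborel (\<lambda>x. indicator {0<..} x *\<^sub>R (- gig_kernel a (\<nu> - 1) s x / 2))"
  proof (rule integral_dominated_convergence)
    show "integrable lborel (\<lambda>x. indicator {0<..} x *\<^sub>R (gig_kernel a (\<nu> - 1) (s / 2) x / 2))"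
      using gig_kernel_integrable[of "s / 2" a "\<nu> - 1"] s a a0
        set_integrable_divide[where a = "2::real" and A = "{0<..}" and f = "gig_kernel a (\<nu> - 1) (s / 2)" and M = lborel]
      by (auto simp: set_integrable_def)
    show "AE x in lborel. (\<lambda>i. q i x) \<longlonglongrightarrow> indicator {0<..} x *\<^sub>R (- gig_kernel a (\<nu> - 1) s x / 2)"
    proof (intro AE_I2)
      fix x :: real
      have "(\<lambda>i. (gig_kernel a \<nu> (X (i + N)) x - gig_kernel a \<nu> s x) / (X (i + N) - s))
          \<longlonglongrightarrow> - gig_kernel a (\<nu> - 1) s x / 2" if x: "0 < x"
      proof -
        have "((\<lambda>t. gig_kernel a \<nu> t x) has_real_derivative - gig_kernel a (\<nu> - 1) s x / 2) (at s)"
          unfolding gig_kernel_shift[OF x] unfolding gig_kernel_def using x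
          by (auto intro!: derivative_eq_intros simp: field_simps)
        then have "((\<lambda>i. (gig_kernel a \<nu> (X i) x - gig_kernel a \<nu> s x) / (X i - s))
          \<longlonglongrightarrow> - gig_kernel a (\<nu> - 1) s x / 2)"
          unfolding has_field_derivative_iff tendsto_at_iff_sequentially
          using X by (auto simp: o_def)
        then show ?thesis by (rule LIMSEQ_ignore_initial_segment)
      qed
      then show "(\<lambda>i. q i x) \<longlonglongrightarrow> indicator {0<..} x *\<^sub>R (- gig_kernel a (\<nu> - 1) s x / 2)"
        by (cases "0 < x") (auto simp: q_def)
    qed
    show "AE x in lborel. norm (q i x) \<le> indicator {0<..} x *\<^sub>R (gig_kernel a (\<nu> - 1) (s / 2) x / 2)" for i
    proof (intro AE_I2)
      fix x :: real
      have "0 < \<bar>X (i + N) - s\<bar>" using X(1) by simp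
      then show "norm (q i x) \<le> indicator {0<..} x *\<^sub>R (gig_kernel a (\<nu> - 1) (s / 2) x / 2)"
        using gig_kernel_lipschitz[of x "s / 2" s "X (i + N)" a \<nu>] N[of i] s
        by (auto simp: q_def indicator_def pos_divide_le_eq mult.commute)
    qed
    show "q i \<in> borel_measurable lborel" for i
      unfolding q_def by measurable
  qed simp
  also have "integral\<^sup>L lborel (\<lambda>x. indicator {0<..} x *\<^sub>R (- gig_kernel a (\<nu> - 1) s x / 2)) = - gig_int a (\<nu> - 1) s / 2"
    by (simp add: gig_int_def set_lebesgue_integral_def)
  finally show "((\<lambda>y. (gig_int a \<nu> y - gig_int a \<nu> s) / (y - s)) \<circ> X) \<longlonglongrightarrow> - gig_int a (\<nu> - 1) s / 2"
    unfolding eq[symmetric] by (rule LIMSEQ_offset)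
qed

section \<open>Relations between integrals of neighbouring orders\<close>

lemma gig_kernel_tendsto_at_top:
  assumes "0 < s" "0 \<le> a" "0 < a \<or> \<nu> < 0"
  shows "(gig_kernel a \<nu> s \<longlongrightarrow> 0) at_top"
proof (cases "0 < a")
  case True
  with \<open>0 < s\<close> show ?thesis unfolding gig_kernel_def by real_asymp
next
  case False
  then have "a = 0" "\<nu> < 0" using assms by auto
  with \<open>0 < s\<close> show ?thesis unfolding gig_kernel_def by (simp, real_asymp)
qed

lemma gig_kernel_tendsto_at_right_0:
  assumes "0 < s"
  shows "(gig_kernel a \<nu> s \<longlongrightarrow> 0) (at_right 0)"
  using assms unfolding gig_kernel_def by real_asymp

text \<open>The left-hand side is the integral of the derivative of
  \<open>gig_kernel a \<nu> s\<close>, which tends to 0 at both ends. This is the three-term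
  recurrence of the Bessel functions.\<close>

lemma gig_int_recurrence:
  assumes s: "0 < s" and a0: "0 \<le> a" and a: "0 < a \<or> \<nu> < 0"
  shows "(\<nu> - 1) * gig_int a (\<nu> - 1) s + s / 2 * gig_int a (\<nu> - 2) s - a / 2 * gig_int a \<nu> s = 0"
proof -
  let ?d = "\<lambda>x. (\<nu> - 1) * gig_kernel a (\<nu> - 1) s x + s / 2 * gig_kernel a (\<nu> - 2) s x - a / 2 * gig_kernel a \<nu> s x"
  have int: "set_integrable lborel {0<..} (gig_kernel a \<kappa> s)" if "\<kappa> \<le> \<nu>" for \<kappa>
    using that s a a0 by (intro gig_kernel_integrable) auto
  have "(LBINT x=0..\<infinity>. ?d x) = 0 - 0"
  proof (rule interval_integral_FTC_integrable[where F = "gig_kernel a \<nu> s"])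
    fix x :: real assume "0 < ereal x"
    then have x: "0 < x" by simp
    have sh: "gig_kernel a (\<nu> - 2) s x = gig_kernel a \<nu> s x / (x * x)"
      using gig_kernel_shift[OF x, of a "\<nu> - 1" s] gig_kernel_shift[OF x, of a "\<nu>" s] by (simp add: diff_diff_eq)
    show "(gig_kernel a \<nu> s has_vector_derivative ?d x) (at x)"
      unfolding has_real_derivative_iff_has_vector_derivative[symmetric]
    proof -
      define p e where "p = x powr (\<nu> - 1)" and "e = exp (- (s / x + a * x) / 2)"
      have P: "((\<lambda>x. x powr (\<nu> - 1)) has_real_derivative (\<nu> - 1) * p / x) (at x)"
        using has_real_derivative_powr[OF x, of "\<nu> - 1"] x by (simp add: p_def powr_diff power2_eq_square)
      have E: "((\<lambda>x. exp (- (s / x + a * x) / 2)) has_real_derivative e * (s / (x * x) - a) / 2) (at x)"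
        using x by (auto intro!: derivative_eq_intros simp: e_def)
      have k: "gig_kernel a \<nu> s x = p * e" by (simp add: gig_kernel_def p_def e_def)
      have "((\<lambda>x. x powr (\<nu> - 1) * exp (- (s / x + a * x) / 2)) has_real_derivative ?d x) (at x)"
        unfolding sh gig_kernel_shift[OF x] k
        by (rule DERIV_cong[OF DERIV_mult[OF P E]])
           (use x in \<open>simp only: p_def[symmetric] e_def[symmetric], simp add: field_simps\<close>)
      then show "(gig_kernel a \<nu> s has_real_derivative ?d x) (at x)"
        unfolding gig_kernel_def[abs_def] .
    qed
    show "isCont ?d x"
      unfolding gig_kernel_def using x by (auto intro!: continuous_intros)
  next
    show "set_integrable lborel (einterval 0 \<infinity>) ?d"
      using int by (auto simp: zero_ereal_def einterval_eq)
    show "((gig_kernel a \<nu> s \<circ> real_of_ereal) \<longlongrightarrow> 0) (at_right 0)"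
      unfolding zero_ereal_def ereal_tendsto_simps using gig_kernel_tendsto_at_right_0[OF s] by simp
    show "((gig_kernel a \<nu> s \<circ> real_of_ereal) \<longlongrightarrow> 0) (at_left \<infinity>)"
      unfolding ereal_tendsto_simps using gig_kernel_tendsto_at_top[OF s a0 a] by simp
  qed auto
  also have "(LBINT x=0..\<infinity>. ?d x) = (\<nu> - 1) * gig_int a (\<nu> - 1) s + s / 2 * gig_int a (\<nu> - 2) s - a / 2 * gig_int a \<nu> s"
    unfolding gig_int_def
    using int[of \<nu>] int[of "\<nu> - 1"] int[of "\<nu> - 2"]
    by (simp add: interval_lebesgue_integral_def zero_ereal_def einterval_eq set_integral_add set_integral_diff)
  finally show ?thesis by simp
qed

text \<open>Cauchy-Schwarz for the functions 1 and 1/x under the weight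
  \<open>gig_kernel a \<nu> s\<close>, obtained by integrating a square.\<close>

lemma gig_int_log_convex:
  assumes s: "0 < s" and a0: "0 \<le> a" and a: "0 < a \<or> \<nu> < 0"
  shows "(gig_int a (\<nu> - 1) s)\<^sup>2 \<le> gig_int a \<nu> s * gig_int a (\<nu> - 2) s"
proof -
  have int: "set_integrable lborel {0<..} (gig_kernel a \<kappa> s)" if "\<kappa> \<le> \<nu>" for \<kappa>
    using that s a a0 by (intro gig_kernel_integrable) auto
  have pos: "0 < gig_int a \<nu> s" using s a a0 by (intro gig_int_pos) auto
  \<comment> \<open>The weighted mean of 1/x, which minimises the integral of (1/x - c)^2 against
    the weight.\<close>
  define c where "c = gig_int a (\<nu> - 1) s / gig_int a \<nu> s"
  have "0 \<le> (LINT x:{0<..}|lborel. gig_kernel a (\<nu> - 2) s x - 2 * c * gig_kernel a (\<nu> - 1) s x + c\<^sup>2 * gig_kernel a \<nu> s x)"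
    unfolding set_lebesgue_integral_def
  proof (intro Bochner_Integration.integral_nonneg)
    fix x :: real
    have "gig_kernel a (\<nu> - 2) s x - 2 * c * gig_kernel a (\<nu> - 1) s x + c\<^sup>2 * gig_kernel a \<nu> s x
        = gig_kernel a \<nu> s x * (1 / x - c)\<^sup>2" if x: "0 < x"
      using gig_kernel_shift[OF x, of a "\<nu> - 1" s] gig_kernel_shift[OF x, of a "\<nu>" s] x
      by (simp add: field_simps power2_eq_square)
    then show "0 \<le> indicator {0<..} x *\<^sub>R (gig_kernel a (\<nu> - 2) s x - 2 * c * gig_kernel a (\<nu> - 1) s x + c\<^sup>2 * gig_kernel a \<nu> s x)"
      using gig_kernel_pos[of x a \<nu> s]
      by (cases "0 < x") (simp_all add: zero_le_mult_iff less_imp_le)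
  qed
  also have "\<dots> = gig_int a (\<nu> - 2) s - 2 * c * gig_int a (\<nu> - 1) s + c\<^sup>2 * gig_int a \<nu> s"
    unfolding gig_int_def
    using int[of \<nu>] int[of "\<nu> - 1"] int[of "\<nu> - 2"]
    by (simp add: set_integral_add set_integral_diff)
  also have "\<dots> = gig_int a (\<nu> - 2) s - (gig_int a (\<nu> - 1) s)\<^sup>2 / gig_int a \<nu> s"
    using pos by (simp add: c_def field_simps power2_eq_square)
  finally show ?thesis using pos by (simp add: field_simps)
qed

lemma gig_int_tendsto:
  assumes "0 \<le> s" "0 \<le> a" "0 < s \<or> 0 < \<nu>" "0 < a \<or> \<nu> < 0"
  shows "(\<lambda>n. gig_int a \<nu> (s + 1 / real (Suc n))) \<longlonglongrightarrow> gig_int a \<nu> s"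
proof -
  have "gig_nn a \<nu> (s + 1 / real (Suc n)) = ennreal (gig_int a \<nu> (s + 1 / real (Suc n)))" for n
    using assms(1) by (intro gig_nn_eq assms(2,4)) (auto intro: add_nonneg_pos)
  then have "(\<lambda>n. ennreal (gig_int a \<nu> (s + 1 / real (Suc n)))) \<longlonglongrightarrow> ennreal (gig_int a \<nu> s)"
    using gig_nn_tendsto[of a \<nu> s] gig_nn_eq[OF assms] by simp
  moreover have "0 \<le> gig_int a \<nu> (s + 1 / real (Suc n))" for n
    using assms(1) by (intro less_imp_le gig_int_pos assms(2,4)) (auto intro: add_nonneg_pos)
  moreover have "0 \<le> gig_int a \<nu> s"
    using gig_int_pos[OF assms] by simp
  ultimately show ?thesis by (simp add: tendsto_ennreal_iff)
qed

text \<open>Makes the normalizing constant of the density positive. Integrability has to come first,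
  since a divergent Bochner integral would be \<open>0\<close>; it follows from
  \<open>cosh t >= exp t / 2\<close>, which makes the first factor decay doubly
  exponentially.\<close>

lemma Bessel_K_pos:
  assumes "0 < z"
  shows "0 < Bessel_K \<nu> z"
proof -
  \<comment> \<open>Decay of order \<open>exp (- N * t)\<close> then outweighs the growth of
    \<open>cosh (\<nu> * t)\<close> and still leaves a factor \<open>exp (- t)\<close>.\<close>
  obtain N :: nat where N: "\<bar>\<nu>\<bar> + 1 < N" using reals_Archimedean2 by blast
  have bound: "exp (- z * cosh t) * cosh (\<nu> * t) \<le> (2 * N / z) ^ N * exp (- t)" if "0 < t" for t
  proof -
    have "z * exp t / 2 \<le> z * cosh t"
      using assms by (simp add: cosh_def field_simps)
    then have "exp (- z * cosh t) \<le> exp (- (z * exp t / 2))" by simp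
    also have "\<dots> \<le> (N / (z * exp t / 2)) ^ N"
      using assms by (intro exp_minus_le_power) simp
    also have "\<dots> = (2 * N / z) ^ N * exp (- (N * t))"
      using exp_of_nat_mult[of N t] by (simp add: power_mult_distrib power_divide exp_minus field_simps)
    finally have 1: "exp (- z * cosh t) \<le> (2 * N / z) ^ N * exp (- (N * t))" .
    have "exp (\<nu> * t) \<le> exp (\<bar>\<nu>\<bar> * t)" "exp (- (\<nu> * t)) \<le> exp (\<bar>\<nu>\<bar> * t)"
      using that by (auto simp: abs_if mult_le_cancel_right)
    then have 2: "cosh (\<nu> * t) \<le> exp (\<bar>\<nu>\<bar> * t)"
      by (simp add: cosh_def field_simps del: exp_le_cancel_iff)
    have "exp (- z * cosh t) * cosh (\<nu> * t) \<le> (2 * N / z) ^ N * exp (- (N * t)) * exp (\<bar>\<nu>\<bar> * t)"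
      using assms by (intro mult_mono 1 2) (auto simp: cosh_real_nonneg)
    also have "\<dots> = (2 * N / z) ^ N * exp (- (N * t) + \<bar>\<nu>\<bar> * t)" by (simp only: mult.assoc exp_add)
    also have "\<dots> \<le> (2 * N / z) ^ N * exp (- t)"
    proof -
      have "(\<bar>\<nu>\<bar> + 1) * t \<le> N * t" using N that by (intro mult_right_mono) auto
      then show ?thesis using assms by (intro mult_left_mono) (auto simp: algebra_simps)
    qed
    finally show ?thesis .
  qed
  have e: "set_integrable lborel {0<..} (\<lambda>t::real. (2 * N / z) ^ N * exp (- (t * 1)))"
    by (intro set_integrable_mult_right integrable_I0i_exp_mscale) simp
  have "set_integrable lborel {0<..} (\<lambda>t. exp (- z * cosh t) * cosh (\<nu> * t))"
  proof (rule set_integrable_bound[OF e])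
    show "set_borel_measurable lborel {0<..} (\<lambda>t. exp (- z * cosh t) * cosh (\<nu> * t))"
      unfolding set_borel_measurable_def cosh_def by measurable
    have "norm (exp (- z * cosh t) * cosh (\<nu> * t)) \<le> norm ((2 * N / z) ^ N * exp (- (t * 1)))" if "0 < t" for t
    proof -
      have "norm (exp (- z * cosh t) * cosh (\<nu> * t)) = exp (- z * cosh t) * cosh (\<nu> * t)"
        by (simp add: abs_mult cosh_real_abs)
      also have "\<dots> \<le> (2 * N / z) ^ N * exp (- t)" by (rule bound[OF that])
      also have "\<dots> \<le> norm ((2 * N / z) ^ N * exp (- (t * 1)))" using assms by simp
      finally show ?thesis .
    qed
    then show "AE t in lborel. t \<in> {0<..} \<longrightarrow> norm (exp (- z * cosh t) * cosh (\<nu> * t)) \<le> norm ((2 * N / z) ^ N * exp (- (t * 1)))"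
      by (intro AE_I2) simp
  qed
  then show ?thesis
    unfolding Bessel_K_def by (rule set_integral_pos) (simp add: cosh_real_pos)
qed

section \<open>Positive solutions of a Riccati equation\<close>

lemma DERIV_nonneg_mono:
  fixes f f' :: "real \<Rightarrow> real"
  assumes "x \<le> z" and "\<And>t. x \<le> t \<Longrightarrow> t \<le> z \<Longrightarrow> (f has_real_derivative f' t) (at t)"
    and "\<And>t. x \<le> t \<Longrightarrow> t \<le> z \<Longrightarrow> 0 \<le> f' t"
  shows "f x \<le> f z"
  by (rule DERIV_nonneg_imp_nondecreasing[OF assms(1)]) (use assms in blast)

text \<open>Monotonicity is only assumed where \<open>D\<close> is positive. To drop,
  \<open>D\<close> would have to pass a positive level below \<open>D r0\<close> for a first time,
  but up to that time it is positive and hence nondecreasing.\<close>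

lemma stays_above:
  fixes D D' :: "real \<Rightarrow> real"
  assumes D: "\<And>r. r0 \<le> r \<Longrightarrow> (D has_real_derivative D' r) (at r)"
    and D': "\<And>r. r0 \<le> r \<Longrightarrow> 0 < D r \<Longrightarrow> 0 \<le> D' r"
    and r0: "0 < D r0" and r: "r0 \<le> r"
  shows "D r0 \<le> D r"
proof (rule ccontr)
  assume less: "\<not> D r0 \<le> D r"
  \<comment> \<open>A level that is positive, below \<open>D r0\<close> and at least
    \<open>D r\<close>; its first crossing time is the infimum of \<open>S\<close>.\<close>
  define c where "c = (max 0 (D r) + D r0) / 2"
  have c: "0 < c" "D r \<le> c" "c < D r0"
    using less r0 by (auto simp: c_def max_def)
  have cont: "continuous_on {r0..r} D"
    using D by (intro continuous_at_imp_continuous_on ballI) (auto intro: DERIV_isCont)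
  define S where "S = {t \<in> {r0..r}. D t = c}"
  have "\<exists>t\<ge>r0. t \<le> r \<and> D t = c"
    using c r cont by (intro IVT2') auto
  then have "S \<noteq> {}" by (auto simp: S_def)
  moreover have "closed S"
    unfolding S_def by (rule continuous_closed_preimage_constant[OF cont]) simp
  moreover have bdd: "bdd_below S" by (auto simp: S_def bdd_below_def)
  ultimately have Inf: "Inf S \<in> S" by (intro closed_contains_Inf)
  define t where "t = Inf S"
  have t: "r0 \<le> t" "t \<le> r" "D t = c" using Inf by (auto simp: S_def t_def)
  have above: "c \<le> D x" if x: "r0 \<le> x" "x \<le> t" for x
  proof (rule ccontr)
    assume "\<not> c \<le> D x"
    then have "\<exists>z\<ge>r0. z \<le> x \<and> D z = c"
      using c x t cont by (intro IVT2') (auto intro: continuous_on_subset)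
    then obtain z where z: "r0 \<le> z" "z \<le> x" "D z = c" by blast
    then have "t \<le> z"
      unfolding t_def using x t by (intro cInf_lower bdd) (auto simp: S_def)
    with z x have "z = x" by simp
    with z \<open>\<not> c \<le> D x\<close> show False by simp
  qed
  have "D r0 \<le> D t"
    by (rule DERIV_nonneg_mono[where f' = D']) (use t D D' above c in \<open>auto intro: order_less_le_trans\<close>)
  with c t show False by simp
qed

text \<open>The function lies below a line of slope \<open>- \<delta>\<close>, which vanishes at
  \<open>r0 + y r0 / \<delta>\<close>. This closes most of the contradiction arguments
  below.\<close>

lemma not_pos_if_deriv_le_neg:
  fixes y Y :: "real \<Rightarrow> real"
  assumes y: "\<And>r. r0 \<le> r \<Longrightarrow> (y has_real_derivative Y r) (at r)"
    and Y: "\<And>r. r0 \<le> r \<Longrightarrow> Y r \<le> - \<delta>" and \<delta>: "0 < \<delta>"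
  shows "\<exists>r\<ge>r0. y r \<le> 0"
proof (cases "y r0 \<le> 0")
  case False
  define r where "r = r0 + y r0 / \<delta>"
  have r: "r0 \<le> r" using False \<delta> by (simp add: r_def)
  have "- y r0 - \<delta> * r0 \<le> - y r - \<delta> * r"
  proof (rule DERIV_nonneg_mono[where f = "\<lambda>t. - y t - \<delta> * t" and f' = "\<lambda>t. - Y t - \<delta>"])
    fix t assume "r0 \<le> t"
    then show "((\<lambda>t. - y t - \<delta> * t) has_real_derivative - Y t - \<delta>) (at t)"
      by (auto intro!: derivative_eq_intros y)
    show "0 \<le> - Y t - \<delta>" using Y[OF \<open>r0 \<le> t\<close>] by simp
  qed (rule r)
  moreover have "\<delta> * r = \<delta> * r0 + y r0" using \<delta> by (simp add: r_def field_simps)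
  ultimately show ?thesis using r by (intro exI[of _ r]) auto
qed auto

locale riccati =
  fixes y :: "real \<Rightarrow> real" and a m :: real
  assumes a_nonneg: "0 \<le> a"
    and y_pos: "\<And>r. 0 < r \<Longrightarrow> 0 < y r"
    and y_deriv: "\<And>r. 0 < r \<Longrightarrow> (y has_real_derivative (y r)\<^sup>2 - a + m * y r / r) (at r)"
begin

text \<open>The derivative of \<open>y\<close>, written as the right-hand side of the equation so
  that it can be differentiated once more.\<close>

definition Y :: "real \<Rightarrow> real" where "Y r = (y r)\<^sup>2 - a + m * y r / r"

lemma y_deriv': "0 < r \<Longrightarrow> (y has_real_derivative Y r) (at r)"
  unfolding Y_def by (rule y_deriv)

text \<open>A linear equation for \<open>Y\<close> whose forcing term has the sign of
  \<open>- m\<close>. This is what propagates the wrong sign of \<open>Y\<close> in the next two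
  lemmas.\<close>

lemma Y_deriv:
  assumes "0 < r"
  shows "(Y has_real_derivative (2 * y r + m / r) * Y r - m * y r / r\<^sup>2) (at r)"
  unfolding Y_def[abs_def]
  using assms
  by (auto intro!: derivative_eq_intros y_deriv simp: field_simps power2_eq_square)

text \<open>A negative value of \<open>Y\<close> would persist and could only become more negative,
  and \<open>y\<close> would reach 0.\<close>

lemma Y_nonneg:
  assumes m: "0 \<le> m" and r: "0 < r"
  shows "0 \<le> Y r"
proof (rule ccontr)
  assume "\<not> 0 \<le> Y r"
  then have neg: "0 < - Y r" by simp
  have "- Y r \<le> - Y t" if t: "r \<le> t" for t
  proof (rule stays_above[where D = "\<lambda>t. - Y t" and D' = "\<lambda>t. - ((2 * y t + m / t) * Y t - m * y t / t\<^sup>2)", OF _ _ neg t])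
    fix t assume "r \<le> t"
    with r have t: "0 < t" by simp
    show "((\<lambda>t. - Y t) has_real_derivative - ((2 * y t + m / t) * Y t - m * y t / t\<^sup>2)) (at t)"
      by (rule DERIV_minus[OF Y_deriv[OF t]])
    assume "0 < - Y t"
    then have "(2 * y t + m / t) * Y t \<le> 0"
      using y_pos[OF t] m t by (intro mult_nonneg_nonpos) auto
    moreover have "0 \<le> m * y t / t\<^sup>2" using y_pos[OF t] m by simp
    ultimately show "0 \<le> - ((2 * y t + m / t) * Y t - m * y t / t\<^sup>2)" by simp
  qed
  then have "\<exists>t\<ge>r. y t \<le> 0"
    using r neg by (intro not_pos_if_deriv_le_neg[where Y = Y and \<delta> = "- Y r"] y_deriv') auto
  then show False using y_pos r by (meson less_le_trans not_less)
qed

text \<open>A positive value of \<open>Y\<close> would persist and make \<open>y\<close> grow at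
  least linearly, against the bound \<open>B\<close>.\<close>

lemma Y_nonpos:
  assumes m: "m \<le> 0" and r: "0 < r" and bound: "\<And>t. r \<le> t \<Longrightarrow> y t \<le> B"
  shows "Y r \<le> 0"
proof (rule ccontr)
  assume "\<not> Y r \<le> 0"
  then have pos: "0 < Y r" by simp
  have ge: "Y r \<le> Y t" if t: "r \<le> t" for t
  proof (rule stays_above[where D = Y, OF _ _ pos t])
    fix t assume "r \<le> t"
    with r have t: "0 < t" by simp
    show "(Y has_real_derivative (2 * y t + m / t) * Y t - m * y t / t\<^sup>2) (at t)"
      by (rule Y_deriv[OF t])
    assume Yt: "0 < Y t"
    \<comment> \<open>The product is \<open>Y t + a\<close>. Its positivity makes the coefficient
      \<open>2 * y t + m / t\<close> positive although \<open>m <= 0\<close>.\<close>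
    then have "0 < y t * (y t + m / t)"
      using a_nonneg by (simp add: Y_def power2_eq_square algebra_simps)
    then have "0 < y t + m / t" using y_pos[OF t] by (simp add: zero_less_mult_iff)
    then have "0 \<le> (2 * y t + m / t) * Y t" using Yt y_pos[OF t] by (intro mult_nonneg_nonneg) auto
    moreover have "m * y t / t\<^sup>2 \<le> 0"
      using y_pos[OF t] m by (simp add: divide_nonpos_nonneg mult_nonpos_nonneg)
    ultimately show "0 \<le> (2 * y t + m / t) * Y t - m * y t / t\<^sup>2" by simp
  qed
  have "\<exists>t\<ge>r. B + 1 - y t \<le> 0"
  proof (rule not_pos_if_deriv_le_neg[where y = "\<lambda>t. B + 1 - y t" and Y = "\<lambda>t. - Y t" and \<delta> = "Y r"])
    fix t assume "r \<le> t"
    with r have t: "0 < t" by simp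
    show "((\<lambda>t. B + 1 - y t) has_real_derivative - Y t) (at t)"
      by (auto intro!: derivative_eq_intros y_deriv'[OF t])
  qed (use ge pos in auto)
  then show False using bound by fastforce
qed

text \<open>Since \<open>y\<close> is nonincreasing, a value below sqrt(a) stays below, and then
  \<open>Y\<close> is bounded away from 0 by a negative constant.\<close>

lemma y_ge_limit:
  assumes m: "m \<le> 0" and Y: "\<And>r. 0 < r \<Longrightarrow> Y r \<le> 0" and r: "0 < r"
  shows "a \<le> (y r)\<^sup>2"
proof (rule ccontr)
  assume "\<not> a \<le> (y r)\<^sup>2"
  then have less: "0 < a - (y r)\<^sup>2" by simp
  have "\<exists>t\<ge>r. y t \<le> 0"
  proof (rule not_pos_if_deriv_le_neg[where Y = Y and \<delta> = "a - (y r)\<^sup>2"])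
    fix t assume rt: "r \<le> t"
    with r have t: "0 < t" by simp
    show "(y has_real_derivative Y t) (at t)" by (rule y_deriv'[OF t])
    have "- y r \<le> - y t"
      by (rule DERIV_nonneg_mono[where f = "\<lambda>t. - y t" and f' = "\<lambda>t. - Y t", OF rt])
         (use r Y in \<open>auto intro!: derivative_eq_intros y_deriv'\<close>)
    then have "(y t)\<^sup>2 \<le> (y r)\<^sup>2" using y_pos[OF t] by (intro power_mono) auto
    moreover have "m * y t / t \<le> 0"
      using y_pos[OF t] m t by (simp add: divide_nonpos_nonneg mult_nonpos_nonneg)
    ultimately show "Y t \<le> - (a - (y r)\<^sup>2)" by (simp add: Y_def)
  qed (rule less)
  then show False using y_pos r by (meson less_le_trans not_less)
qed

text \<open>At a point of equality \<open>Y r = m * y r / r\<close> is negative, so \<open>y\<close>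
  would go below sqrt(a) just afterwards.\<close>

lemma y_gt_limit:
  assumes m: "m < 0" and Y: "\<And>r. 0 < r \<Longrightarrow> Y r \<le> 0" and r: "0 < r"
  shows "a < (y r)\<^sup>2"
proof (rule ccontr)
  assume "\<not> a < (y r)\<^sup>2"
  then have "(y r)\<^sup>2 = a"
    using y_ge_limit[OF less_imp_le[OF m] Y r] by simp
  then have "Y r = m * y r / r" unfolding Y_def by simp
  then have "Y r < 0"
    using m y_pos[OF r] r by (simp add: divide_neg_pos mult_neg_pos)
  then obtain d where d: "0 < d" "\<And>h. 0 < h \<Longrightarrow> h < d \<Longrightarrow> y (r + h) < y r"
    using DERIV_neg_dec_right[OF y_deriv'[OF r]] by blast
  have h: "0 < r + d / 2" using r d by simp
  have "(y (r + d / 2))\<^sup>2 < (y r)\<^sup>2"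
    using d(2)[of "d / 2"] d(1) y_pos[OF h] by (intro power_strict_mono) auto
  with y_ge_limit[OF less_imp_le[OF m] Y h] \<open>\<not> a < (y r)\<^sup>2\<close> show False by simp
qed

text \<open>The conclusion says that the derivative of \<open>\<alpha> * r / y r\<close> is at most \<open>1\<close>.\<close>

lemma ratio_slope_le_1:
  assumes m: "m \<le> 0" and \<alpha>: "0 < \<alpha>" "\<alpha>\<^sup>2 = a" and ge: "\<And>r. 0 < r \<Longrightarrow> \<alpha> \<le> y r" and r: "0 < r"
  shows "\<alpha> * (y r - r * Y r) \<le> (y r)\<^sup>2"
proof (rule ccontr)
  assume not_le: "\<not> \<alpha> * (y r - r * Y r) \<le> (y r)\<^sup>2"
  define n where "n = 1 - m"
  define p where "p t = \<alpha> * t / y t" for t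
  \<comment> \<open>This is the derivative of \<open>p\<close>, with \<open>y\<close> eliminated by
    the Riccati equation: \<open>p\<close> solves an equation of the same type. The negated goal
    says \<open>P r > 1\<close>, and the aim is to show that \<open>P\<close> then never returns
    below \<open>P r\<close>.\<close>
  define P where "P t = n * p t / t - \<alpha> * t + \<alpha> * (p t)\<^sup>2 / t" for t
  have n: "1 \<le> n" using m by (simp add: n_def)
  have p0: "0 < p t" if "0 < t" for t using that y_pos[OF that] \<alpha> by (simp add: p_def)
  have pt: "p t \<le> t" if "0 < t" for t
    using that y_pos[OF that] ge[OF that] by (simp add: p_def field_simps)
  have P_eq: "P t = \<alpha> * (y t - t * Y t) / (y t)\<^sup>2" if "0 < t" for t
  proof -
    have "P t = \<alpha> * (n * y t - t * (y t)\<^sup>2 + \<alpha>\<^sup>2 * t) / (y t)\<^sup>2"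
      using that y_pos[OF that] by (simp add: P_def p_def power2_eq_square field_simps)
    also have "n * y t - t * (y t)\<^sup>2 + \<alpha>\<^sup>2 * t = y t - t * Y t"
      using that unfolding Y_def \<alpha>(2) n_def by (simp add: field_simps)
    finally show ?thesis .
  qed
  have p_deriv: "(p has_real_derivative P t) (at t)" if t: "0 < t" for t
    unfolding P_eq[OF t] unfolding p_def[abs_def] using y_pos[OF t]
    by (auto intro!: derivative_eq_intros y_deriv'[OF t] simp: field_simps power2_eq_square)
  have P_deriv: "(P has_real_derivative ((n - 1) * P t - 2 * \<alpha> * (t - p t * P t)) / t) (at t)" if t: "0 < t" for t
  proof -
    have "(P has_real_derivative n * (P t * t - p t) / (t * t) - \<alpha> + \<alpha> * (2 * p t * P t * t - (p t)\<^sup>2) / (t * t)) (at t)"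
    proof -
      define q where "q = P t"
      have q: "(p has_real_derivative q) (at t)" unfolding q_def by (rule p_deriv[OF t])
      show ?thesis
        unfolding q_def[symmetric] unfolding P_def[abs_def] using t
        by (auto intro!: derivative_eq_intros q simp: field_simps power2_eq_square)
    qed
    also have "n * (P t * t - p t) / (t * t) - \<alpha> + \<alpha> * (2 * p t * P t * t - (p t)\<^sup>2) / (t * t)
        = (n * P t * t + 2 * \<alpha> * p t * P t * t - \<alpha> * t * t - (n * p t + \<alpha> * (p t)\<^sup>2)) / (t * t)"
      using t by (simp add: field_simps)
    also have "n * p t + \<alpha> * (p t)\<^sup>2 = t * P t + \<alpha> * t * t"
      using t by (simp add: P_def field_simps)
    also have "(n * P t * t + 2 * \<alpha> * p t * P t * t - \<alpha> * t * t - (t * P t + \<alpha> * t * t)) / (t * t)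
        = ((n - 1) * P t - 2 * \<alpha> * (t - p t * P t)) / t"
      using t by (simp add: field_simps)
    finally show ?thesis .
  qed
  have P1: "0 < P r - 1"
    using not_le y_pos[OF r] by (simp add: P_eq[OF r] field_simps)
  have stay: "P r - 1 \<le> P t - 1" if t: "r \<le> t" for t
  proof (rule stays_above[where D = "\<lambda>t. P t - 1", OF _ _ P1 t])
    fix t assume "r \<le> t"
    with r have t: "0 < t" by simp
    show "((\<lambda>t. P t - 1) has_real_derivative ((n - 1) * P t - 2 * \<alpha> * (t - p t * P t)) / t) (at t)"
      using DERIV_diff[OF P_deriv[OF t] DERIV_const[of 1]] by simp
    assume "0 < P t - 1"
    then have P: "1 < P t" by simp
    \<comment> \<open>Inserting the formula for \<open>P\<close> into \<open>P t > 1\<close> bounds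
      the gap \<open>t - p t\<close>. The result, \<open>2 * \<alpha> * (t - p t) <= n - 1\<close>,
      is what makes the derivative of \<open>P\<close> nonnegative.\<close>
    have "t * 1 < t * P t" using P t by (intro mult_strict_left_mono) auto
    also have "t * P t = n * p t - \<alpha> * (t - p t) * (t + p t)"
      using t by (simp add: P_def field_simps power2_eq_square)
    finally have "(t - p t) * (1 + \<alpha> * (t + p t)) \<le> (n - 1) * p t"
      by (simp add: algebra_simps)
    moreover have "(t - p t) * (2 * \<alpha> * p t) \<le> (t - p t) * (1 + \<alpha> * (t + p t))"
    proof (intro mult_left_mono)
      have "\<alpha> * p t \<le> \<alpha> * t" using pt[OF t] \<alpha> by simp
      then show "2 * \<alpha> * p t \<le> 1 + \<alpha> * (t + p t)" by (simp add: algebra_simps)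
    qed (use pt[OF t] in simp)
    ultimately have "(2 * \<alpha> * (t - p t)) * p t \<le> (n - 1) * p t" by (simp add: algebra_simps)
    then have "2 * \<alpha> * (t - p t) \<le> n - 1" using p0[OF t] by simp
    also have "n - 1 \<le> (n - 1) * P t" using n P by (simp add: mult_le_cancel_left1)
    finally have "2 * \<alpha> * (t - p t) \<le> (n - 1) * P t" .
    moreover have "2 * \<alpha> * (t - p t * P t) \<le> 2 * \<alpha> * (t - p t)"
      using \<alpha> P p0[OF t] by (intro mult_left_mono) (auto simp: mult_le_cancel_left1)
    ultimately show "0 \<le> ((n - 1) * P t - 2 * \<alpha> * (t - p t * P t)) / t" using t by simp
  qed
  \<comment> \<open>With its slope staying above 1 by a fixed amount, \<open>p\<close> overtakes the
    identity, against \<open>p t <= t\<close>.\<close>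
  have "\<exists>t\<ge>r. t - p t + 1 \<le> 0"
    by (rule not_pos_if_deriv_le_neg[where y = "\<lambda>t. t - p t + 1" and Y = "\<lambda>t. 1 - P t" and \<delta> = "P r - 1"])
       (use r stay P1 in \<open>auto intro!: derivative_eq_intros p_deriv\<close>)
  then obtain t where "r \<le> t" "t - p t + 1 \<le> 0" by blast
  with pt[of t] r show False by simp
qed

text \<open>If \<open>y\<close> stayed above \<open>l\<close>, then \<open>Y\<close> would be at
  least \<open>m * l / r - a\<close>, and the logarithmic divergence at 0 would make
  \<open>y\<close> negative there.\<close>

lemma y_small_near_0:
  assumes m: "0 < m" and l: "0 < l"
  shows "\<exists>t>0. y t < l"
proof (rule ccontr)
  assume "\<not> (\<exists>t>0. y t < l)"
  then have ge: "l \<le> y t" if "0 < t" for t using that by (meson not_less)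
  \<comment> \<open>Solves \<open>m * l * ln t = - (y 1 + a)\<close>, so that the integrated
    inequality becomes \<open>y t + a * t <= 0\<close>.\<close>
  define t where "t = exp (- ((y 1 + a) / (m * l)))"
  have t: "0 < t" "t \<le> 1" using y_pos[of 1] a_nonneg m l by (auto simp: t_def)
  have "y t - m * l * ln t + a * t \<le> y 1 - m * l * ln 1 + a * 1"
  proof (rule DERIV_nonneg_mono[where f = "\<lambda>t. y t - m * l * ln t + a * t" and f' = "\<lambda>x. Y x - m * l / x + a"])
    fix x assume "t \<le> x"
    with t have x: "0 < x" by simp
    show "((\<lambda>t. y t - m * l * ln t + a * t) has_real_derivative Y x - m * l / x + a) (at x)"
      using x by (auto intro!: derivative_eq_intros y_deriv' simp: field_simps)
    have "m * l / x \<le> m * y x / x" using m x ge[OF x] by (simp add: divide_right_mono)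
    then show "0 \<le> Y x - m * l / x + a" by (simp add: Y_def)
  qed (rule t)
  moreover have "m * l * ln t = - (y 1 + a)" using m l by (simp add: t_def)
  moreover have "0 \<le> a * t" using a_nonneg t by simp
  ultimately show False using y_pos[OF t(1)] by simp
qed

text \<open>With \<open>w = sqrt (chi + t\<^sup>2)\<close>, the quantity \<open>t * y w / w\<close> is the derivative of
  \<open>\<Phi> w\<close> in \<open>t\<close>, for a primitive \<open>\<Phi>\<close> of \<open>y\<close>.\<close>

lemma not_mono_slope:
  assumes m: "m < 0" and Yle: "\<And>r. 0 < r \<Longrightarrow> Y r \<le> 0"
    and bound: "\<And>r. 0 < r \<Longrightarrow> y r \<le> sqrt a + k / r" and k: "0 \<le> k" and chi: "0 \<le> chi"
    and mono: "\<And>s t. 0 < s \<Longrightarrow> s \<le> t \<Longrightarrow>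
      s * y (sqrt (chi + s\<^sup>2)) / sqrt (chi + s\<^sup>2) \<le> t * y (sqrt (chi + t\<^sup>2)) / sqrt (chi + t\<^sup>2)"
  shows False
proof -
  have w: "t \<le> sqrt (chi + t\<^sup>2)" "0 < sqrt (chi + t\<^sup>2)" if "0 < t" for t
    using that chi by (auto intro!: real_le_rsqrt add_nonneg_pos)
  \<comment> \<open>A nondecreasing function stays below any upper bound valid in the limit, and
    \<open>bound\<close> provides sqrt(a) up to the vanishing error k/t.\<close>
  have v: "s * y (sqrt (chi + s\<^sup>2)) / sqrt (chi + s\<^sup>2) \<le> sqrt a" if s: "0 < s" for s
  proof (rule field_le_epsilon)
    fix e :: real assume e: "0 < e"
    define t where "t = max s (k / e + 1)"
    have t: "s \<le> t" "0 < t" "k / t \<le> e"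
      using s e k by (auto simp: t_def max_def field_simps add_nonneg_pos)
    have "s * y (sqrt (chi + s\<^sup>2)) / sqrt (chi + s\<^sup>2) \<le> t * y (sqrt (chi + t\<^sup>2)) / sqrt (chi + t\<^sup>2)"
      by (rule mono[OF s t(1)])
    also have "\<dots> \<le> y (sqrt (chi + t\<^sup>2))"
      using w[OF t(2)] y_pos[OF w(2)[OF t(2)]] by (simp add: field_simps)
    also have "\<dots> \<le> sqrt a + k / sqrt (chi + t\<^sup>2)" by (rule bound[OF w(2)[OF t(2)]])
    also have "\<dots> \<le> sqrt a + k / t" using w[OF t(2)] t k by (simp add: frac_le)
    also have "\<dots> \<le> sqrt a + e" using t by simp
    finally show "s * y (sqrt (chi + s\<^sup>2)) / sqrt (chi + s\<^sup>2) \<le> sqrt a + e" .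
  qed
  have "0 < sqrt a"
    using v[of 1] y_pos[OF w(2)[of 1]] w(2)[of 1]
    by (smt (verit) divide_pos_pos mult_1)
  then have a: "0 < a" by simp
  \<comment> \<open>The term \<open>m * y r / r\<close> is at most \<open>- 2 * c / r\<close>. For
    \<open>r >= R\<close> the remaining term \<open>(y r)\<^sup>2 - a\<close> is at most
    \<open>c / r\<close>, which leaves \<open>Y r <= - c / r\<close>.\<close>
  define c where "c = - m * sqrt a / 2"
  have c: "0 < c" using m a by (simp add: c_def mult_neg_pos)
  \<comment> \<open>Ensures both \<open>2 * chi < r\<^sup>2\<close> and
    \<open>2 * a * chi <= c * r\<close> for \<open>r >= R\<close>.\<close>
  define R where "R = sqrt (2 * chi) + 1 + 2 * a * chi / c"
  have R_bounds: "0 \<le> sqrt (2 * chi)" "0 \<le> 2 * a * chi / c" using chi a c by auto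
  then have R: "0 < R" unfolding R_def by linarith
  have Yneg: "Y r \<le> - c / r" if r: "R \<le> r" for r
  proof -
    have r0: "0 < r" using r R by simp
    have "sqrt (2 * chi) < r" using r R_bounds chi unfolding R_def by linarith
    then have r2: "2 * chi < r\<^sup>2" using r0 by (smt (verit) real_less_lsqrt real_le_rsqrt)
    then have chi_r: "chi < r\<^sup>2" using chi by simp
    have rc: "2 * a * chi \<le> c * r"
    proof -
      have "2 * a * chi / c \<le> r" using r R_bounds chi unfolding R_def by linarith
      then show ?thesis using c by (simp add: field_simps)
    qed
    define s where "s = sqrt (r\<^sup>2 - chi)"
    have s: "0 < s" "s\<^sup>2 = r\<^sup>2 - chi" "sqrt (chi + s\<^sup>2) = r"
      using chi_r r0 by (auto simp: s_def)
    have "s * y r \<le> sqrt a * r" using v[OF s(1)] r0 unfolding s(3) by (simp add: field_simps)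
    then have "(s * y r)\<^sup>2 \<le> (sqrt a * r)\<^sup>2" using s y_pos[OF r0] by (intro power_mono) auto
    then have "(r\<^sup>2 - chi) * (y r)\<^sup>2 \<le> a * r\<^sup>2" using a by (simp add: power_mult_distrib s(2))
    then have "((y r)\<^sup>2 - a) * (r\<^sup>2 - chi) \<le> a * chi" by (simp add: algebra_simps)
    moreover have "((y r)\<^sup>2 - a) * (r\<^sup>2 / 2) \<le> ((y r)\<^sup>2 - a) * (r\<^sup>2 - chi)"
      using y_ge_limit[OF less_imp_le[OF m] Yle r0] r2 by (intro mult_left_mono) auto
    ultimately have "((y r)\<^sup>2 - a) * r\<^sup>2 \<le> c * r" using rc by simp
    then have "(((y r)\<^sup>2 - a) * r) * r \<le> c * r" by (simp add: power2_eq_square mult.assoc)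
    then have 1: "(y r)\<^sup>2 - a \<le> c / r" using r0 by (simp add: pos_le_divide_eq)
    have "sqrt a \<le> y r"
      using y_ge_limit[OF less_imp_le[OF m] Yle r0] y_pos[OF r0] by (simp add: real_le_lsqrt)
    then have "m * y r \<le> - 2 * c" using m by (simp add: c_def mult_left_mono_neg)
    then have "m * y r / r \<le> - 2 * c / r" using r0 by (intro divide_right_mono) auto
    with 1 show ?thesis by (simp add: Y_def)
  qed
  \<comment> \<open>Integrating \<open>- c / x\<close> from \<open>R\<close> to this point lowers
    \<open>y\<close> by \<open>y R\<close>, so \<open>y r\<close> could not be positive.\<close>
  define r where "r = R * exp (y R / c)"
  have r: "R \<le> r" "0 < r" using R c y_pos[OF R] by (auto simp: r_def mult_le_cancel_left1)
  have "- y R - c * ln R \<le> - y r - c * ln r"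
  proof (rule DERIV_nonneg_mono[where f = "\<lambda>t. - y t - c * ln t" and f' = "\<lambda>x. - Y x - c / x"])
    fix x assume x: "R \<le> x"
    with R have x0: "0 < x" by simp
    show "((\<lambda>t. - y t - c * ln t) has_real_derivative - Y x - c / x) (at x)"
      using x0 by (auto intro!: derivative_eq_intros y_deriv' simp: field_simps)
    show "0 \<le> - Y x - c / x" using Yneg[OF x] by simp
  qed (rule r)
  moreover have "c * ln r = c * ln R + y R"
    using R c by (simp add: r_def ln_mult field_simps)
  ultimately show False using y_pos[OF r(2)] by simp
qed

end

section \<open>The logarithmic slope of the integral\<close>

text \<open>The tangent inequalities at \<open>s\<close> and at \<open>t\<close> are added.\<close>

lemma convex_on_deriv_mono:
  fixes f f' :: "real \<Rightarrow> real"
  assumes f: "convex_on {0<..} f" and f': "\<And>t. 0 < t \<Longrightarrow> (f has_real_derivative f' t) (at t)"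
    and st: "0 < s" "s \<le> t"
  shows "f' s \<le> f' t"
proof (cases "s = t")
  case False
  have tangent: "f' c * (x - c) \<le> f x - f c" if "0 < c" "0 < x" for c x
    by (rule convex_on_imp_above_tangent[OF f, of c x])
       (use that f' in \<open>auto simp: interior_open intro: has_field_derivative_at_within\<close>)
  have "f' s * (t - s) \<le> f' t * (t - s)"
    using tangent[of s t] tangent[of t s] st by (simp add: algebra_simps)
  with False st show ?thesis by simp
qed simp

locale gig_integral =
  fixes a \<nu> :: real
  assumes a0: "0 \<le> a" and a_cases: "0 < a \<or> \<nu> < 0"
begin

text \<open>By \<open>ln_G_deriv\<close> this is -2 times the logarithmic derivative of
  \<open>gig_int a \<nu>\<close>. In Bessel terms, for \<open>a > 0\<close> it equals sqrt(a/s)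
  K_(\<nu>-1)(sqrt(a s)) / K_\<nu>(sqrt(a s)).\<close>

definition ratio :: "real \<Rightarrow> real" where
  "ratio s = gig_int a (\<nu> - 1) s / gig_int a \<nu> s"

text \<open>The derivative of \<open>ratio\<close>; the order \<open>\<nu> - 2\<close> has been
  removed by the recurrence, so that the formula is closed in \<open>ratio\<close>. This is the
  source of the Riccati equation.\<close>

definition ratio' :: "real \<Rightarrow> real" where
  "ratio' s = ((\<nu> - 1) * ratio s - a / 2) / s + (ratio s)\<^sup>2 / 2"

definition slope :: "real \<Rightarrow> real" where
  "slope r = r * ratio (r\<^sup>2)"

lemma G_pos: "0 < s \<Longrightarrow> 0 < gig_int a \<nu> s"
  using a0 a_cases by (intro gig_int_pos) auto

lemma ratio_pos: "0 < s \<Longrightarrow> 0 < ratio s"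
  using a0 a_cases G_pos[of s] gig_int_pos[of s a "\<nu> - 1"] by (auto simp: ratio_def)

lemma G_deriv:
  assumes "0 < s"
  shows "(gig_int a \<nu> has_real_derivative - gig_int a \<nu> s * ratio s / 2) (at s)"
  using gig_int_has_derivative[OF assms a0 a_cases] G_pos[OF assms] by (simp add: ratio_def)

lemma ln_G_deriv:
  assumes "0 < s"
  shows "((\<lambda>s. ln (gig_int a \<nu> s)) has_real_derivative - ratio s / 2) (at s)"
  using G_pos[OF assms] by (auto intro!: derivative_eq_intros G_deriv[OF assms])

lemma recurrence:
  assumes "0 < s"
  shows "gig_int a (\<nu> - 2) s = gig_int a \<nu> s * (a - 2 * (\<nu> - 1) * ratio s) / s"
proof -
  have "gig_int a (\<nu> - 1) s = gig_int a \<nu> s * ratio s"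
    using G_pos[OF assms] by (simp add: ratio_def)
  then have "s * gig_int a (\<nu> - 2) s = gig_int a \<nu> s * (a - 2 * (\<nu> - 1) * ratio s)"
    using gig_int_recurrence[OF assms a0 a_cases] by (simp add: algebra_simps)
  then show ?thesis using assms by (simp add: field_simps)
qed

lemma ratio_deriv:
  assumes s: "0 < s"
  shows "(ratio has_real_derivative ratio' s) (at s)"
proof -
  have 1: "(gig_int a (\<nu> - 1) has_real_derivative - gig_int a (\<nu> - 2) s / 2) (at s)"
    using gig_int_has_derivative[of s a "\<nu> - 1"] s a0 a_cases by auto
  have e: "gig_int a (\<nu> - 1) s = gig_int a \<nu> s * ratio s"
    using G_pos[OF s] by (simp add: ratio_def)
  show ?thesis
    unfolding ratio_def[abs_def]
    by (rule DERIV_cong[OF DERIV_divide[OF 1 G_deriv[OF s]]])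
       (use G_pos[OF s] s in \<open>simp_all add: e recurrence ratio'_def field_simps power2_eq_square\<close>)
qed

text \<open>Log-convexity in the order, with the lowest order eliminated by the recurrence.\<close>

lemma ratio_bound:
  assumes s: "0 < s"
  shows "s * (ratio s)\<^sup>2 \<le> a - 2 * (\<nu> - 1) * ratio s"
proof -
  have "(gig_int a \<nu> s * ratio s)\<^sup>2 \<le> gig_int a \<nu> s * gig_int a (\<nu> - 2) s"
    using gig_int_log_convex[OF s a0 a_cases] G_pos[OF s] by (simp add: ratio_def)
  then have "(gig_int a \<nu> s)\<^sup>2 * (ratio s)\<^sup>2 \<le> (gig_int a \<nu> s)\<^sup>2 * ((a - 2 * (\<nu> - 1) * ratio s) / s)"
    by (simp add: recurrence[OF s] power2_eq_square mult_ac)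
  then have "(ratio s)\<^sup>2 \<le> (a - 2 * (\<nu> - 1) * ratio s) / s"
    by (rule mult_left_le_imp_le) (use G_pos[OF s] in simp)
  then show ?thesis using s by (simp add: field_simps)
qed

lemma slope_deriv:
  assumes r: "0 < r"
  shows "(slope has_real_derivative (slope r)\<^sup>2 - a + (2 * \<nu> - 1) * slope r / r) (at r)"
proof -
  have r2: "0 < r\<^sup>2" using r by simp
  have 1: "((\<lambda>r. ratio (r\<^sup>2)) has_real_derivative ratio' (r\<^sup>2) * (2 * r)) (at r)"
    by (rule DERIV_chain2[where f = ratio and g = "\<lambda>r. r\<^sup>2", OF ratio_deriv[OF r2]]) (auto intro!: derivative_eq_intros)
  show ?thesis
    unfolding slope_def[abs_def]
    by (rule DERIV_cong[OF DERIV_mult[OF DERIV_ident 1]])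
       (use r in \<open>simp add: ratio'_def field_simps power2_eq_square\<close>)
qed

sublocale riccati slope a "2 * \<nu> - 1"
  by unfold_locales (use a0 ratio_pos slope_deriv in \<open>auto simp: slope_def\<close>)

text \<open>With \<open>k = 2 * \<bar>\<nu> - 1\<bar>\<close>, \<open>ratio_bound\<close> becomes
  \<open>y * (y - k / r) <= a\<close> for \<open>y = slope r\<close>. If the second factor exceeded
  sqrt(a), so would the first.\<close>

lemma slope_le:
  assumes r: "0 < r"
  shows "slope r \<le> sqrt a + 2 * \<bar>\<nu> - 1\<bar> / r"
proof (rule ccontr)
  define k where "k = 2 * \<bar>\<nu> - 1\<bar>"
  assume "\<not> slope r \<le> sqrt a + 2 * \<bar>\<nu> - 1\<bar> / r"
  then have gt: "sqrt a < slope r - k / r" by (simp add: k_def)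
  have "(slope r)\<^sup>2 \<le> a - 2 * (\<nu> - 1) * ratio (r\<^sup>2)"
    using ratio_bound[of "r\<^sup>2"] r by (simp add: slope_def power_mult_distrib)
  also have "\<dots> \<le> a + k * ratio (r\<^sup>2)"
  proof -
    have "- 2 * (\<nu> - 1) * ratio (r\<^sup>2) \<le> k * ratio (r\<^sup>2)"
      using ratio_pos[of "r\<^sup>2"] r by (intro mult_right_mono) (auto simp: k_def abs_if)
    then show ?thesis by (simp add: algebra_simps)
  qed
  also have "k * ratio (r\<^sup>2) = slope r * (k / r)" using r by (simp add: slope_def)
  finally have "slope r * (slope r - k / r) \<le> a" by (simp add: power2_eq_square algebra_simps)
  moreover have "sqrt a * sqrt a < slope r * (slope r - k / r)"
  proof -
    have "0 \<le> k / r" using r by (simp add: k_def)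
    then have "sqrt a < slope r" using gt by linarith
    with gt a0 y_pos[OF r] show ?thesis by (intro mult_strict_mono) auto
  qed
  ultimately show False using a0 by simp
qed

lemma Y_nonpos':
  assumes "\<nu> \<le> 1 / 2" "0 < r"
  shows "Y r \<le> 0"
proof (rule Y_nonpos)
  fix t assume t: "r \<le> t"
  then have "2 * \<bar>\<nu> - 1\<bar> / t \<le> 2 * \<bar>\<nu> - 1\<bar> / r"
    using assms by (intro divide_left_mono) auto
  then show "slope t \<le> sqrt a + 2 * \<bar>\<nu> - 1\<bar> / r"
    using slope_le[of t] t assms by simp
qed (use assms in auto)

lemma slope_ge_sqrt:
  assumes "\<nu> \<le> 1 / 2" "0 < r"
  shows "sqrt a \<le> slope r"
  using y_ge_limit[OF _ Y_nonpos' assms(2)] assms y_pos[OF assms(2)] by (simp add: real_le_lsqrt)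

text \<open>After division by \<open>a * (ratio s) ^ 3\<close> this says that the derivative of
  \<open>1 / (ratio s)\<^sup>2\<close> is below \<open>1 / a\<close>. It combines
  \<open>ratio_slope_le_1\<close> with the strict bound \<open>a < (slope r)\<^sup>2\<close>, which
  yields strictness.\<close>

lemma ratio_inv_sq_slope:
  assumes \<nu>: "\<nu> < 1 / 2" and a: "0 < a" and s: "0 < s"
  shows "- 2 * a * ratio' s < (ratio s) ^ 3"
proof -
  define r where "r = sqrt s"
  have r: "0 < r" "r\<^sup>2 = s" using s by (auto simp: r_def)
  have y: "slope r = r * ratio s" using r by (simp add: slope_def)
  have Y: "Y r = ratio s + 2 * s * ratio' s"
    unfolding Y_def y r(2)[symmetric] using r(1)
    by (simp add: ratio'_def field_simps power2_eq_square)
  have "sqrt a * (slope r - r * Y r) \<le> (slope r)\<^sup>2"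
    by (rule ratio_slope_le_1) (use \<nu> a slope_ge_sqrt r in auto)
  then have "r\<^sup>2 * (sqrt a * (- 2 * r * ratio' s)) \<le> r\<^sup>2 * (ratio s)\<^sup>2"
    unfolding y Y r(2)[symmetric] by (simp add: algebra_simps power2_eq_square)
  then have 1: "sqrt a * (- 2 * r * ratio' s) \<le> (ratio s)\<^sup>2"
    by (rule mult_left_le_imp_le) (use r s in simp)
  have "a < (slope r)\<^sup>2"
    by (rule y_gt_limit) (use \<nu> r Y_nonpos' in auto)
  then have 2: "sqrt a < r * ratio s"
    using r ratio_pos[OF s] unfolding y by (simp add: real_less_lsqrt)
  have "r * (- 2 * a * ratio' s) = sqrt a * (sqrt a * (- 2 * r * ratio' s))"
    using a by (simp add: algebra_simps flip: real_sqrt_mult)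
  also have "\<dots> \<le> sqrt a * (ratio s)\<^sup>2" using 1 a by (intro mult_left_mono) auto
  also have "\<dots> < r * ratio s * (ratio s)\<^sup>2" using 2 ratio_pos[OF s] by (intro mult_strict_right_mono) auto
  also have "\<dots> = r * (ratio s) ^ 3" by (simp add: power2_eq_square power3_eq_cube)
  finally show ?thesis by (rule mult_left_less_imp_less) (use r in simp)
qed

text \<open>The logarithm of \<open>gig_int a \<nu>\<close> along a line that meets \<open>s > 0\<close> only, plus a linear term,
  has negative second derivative at each critical point.\<close>

lemma line_quasi_concave:
  assumes \<nu>: "\<nu> < 1 / 2" and a: "0 < a" and D: "0 < D" and A: "A\<^sup>2 \<le> a * D"
    and s: "\<And>t. 0 < N + 2 * t * B + t\<^sup>2 * D" and t: "0 \<le> t" "t \<le> 1"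
  defines "g \<equiv> \<lambda>t. t * A + ln (gig_int a \<nu> (N + 2 * t * B + t\<^sup>2 * D))"
  shows "min (g 0) (g 1) \<le> g t"
proof (rule ccontr)
  assume less: "\<not> min (g 0) (g 1) \<le> g t"
  define S where "S t = N + 2 * t * B + t\<^sup>2 * D" for t
  define g1 where "g1 t = A - ratio (S t) * (B + t * D)" for t
  define g2 where "g2 t = - (ratio' (S t) * (2 * (B + t * D)) * (B + t * D) + ratio (S t) * D)" for t
  have S_pos: "0 < S t" for t using s by (simp add: S_def)
  have S_deriv: "(S has_real_derivative 2 * (B + t * D)) (at t)" for t
    unfolding S_def[abs_def] by (auto intro!: derivative_eq_intros simp: algebra_simps)
  have g_deriv: "(g has_real_derivative g1 t) (at t)" for t
  proof -
    have "((\<lambda>t. ln (gig_int a \<nu> (S t))) has_real_derivative - ratio (S t) / 2 * (2 * (B + t * D))) (at t)"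
      by (rule DERIV_chain2[where f = "\<lambda>s. ln (gig_int a \<nu> s)" and g = S, OF ln_G_deriv[OF S_pos] S_deriv])
    from DERIV_add[OF DERIV_cmult_right[OF DERIV_ident, of A] this] show ?thesis
      unfolding g_def S_def[symmetric] g1_def by (simp add: algebra_simps)
  qed
  have g1_deriv: "(g1 has_real_derivative g2 t) (at t)" for t
  proof -
    have "((\<lambda>t. ratio (S t)) has_real_derivative ratio' (S t) * (2 * (B + t * D))) (at t)"
      by (rule DERIV_chain2[where f = ratio and g = S, OF ratio_deriv[OF S_pos] S_deriv])
    then show ?thesis
      unfolding g1_def[abs_def] g2_def by (auto intro!: derivative_eq_intros)
  qed
  \<comment> \<open>If the claim fails, the minimum of \<open>g\<close> over the unit interval lies
    at an interior point \<open>z\<close>. It is a critical point, and a negative second derivative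
    there is impossible.\<close>
  have "continuous_on {0..1} g"
    by (intro continuous_at_imp_continuous_on ballI DERIV_isCont[OF g_deriv])
  then obtain z where z: "z \<in> {0..1}" "\<And>x. x \<in> {0..1} \<Longrightarrow> g z \<le> g x"
    using continuous_attains_inf[of "{0..1::real}" g] by auto
  have "g z < g 0" "g z < g 1" using z(2)[of t] t less by auto
  then have "z \<noteq> 0" "z \<noteq> 1" by auto
  with z(1) have z01: "0 < z" "z < 1" by auto
  have "g1 z = 0"
    by (rule DERIV_local_min[OF g_deriv, of "min z (1 - z)"]) (use z z01 in \<open>auto simp: abs_if split: if_splits\<close>)
  \<comment> \<open>Criticality turns the hypothesis on \<open>A\<close> into a bound for
    \<open>(ratio (S z))\<^sup>2 * (B + z * D)\<^sup>2\<close>, just what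
    \<open>ratio_inv_sq_slope\<close> needs to give \<open>g2 z < 0\<close>.\<close>
  then have crit: "A = ratio (S z) * (B + z * D)" by (simp add: g1_def)
  have "g2 z < 0"
  proof (cases "B + z * D = 0")
    case True
    then show ?thesis using ratio_pos[OF S_pos, of z] D by (simp add: g2_def)
  next
    case False
    have "a * (- 2 * ratio' (S z) * (B + z * D)\<^sup>2) = (- 2 * a * ratio' (S z)) * (B + z * D)\<^sup>2" by simp
    also have "\<dots> < (ratio (S z)) ^ 3 * (B + z * D)\<^sup>2"
      using False by (intro mult_strict_right_mono ratio_inv_sq_slope \<nu> a S_pos) auto
    also have "\<dots> = ratio (S z) * A\<^sup>2" unfolding crit by (simp add: power2_eq_square power3_eq_cube)
    also have "\<dots> \<le> ratio (S z) * (a * D)"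
      using ratio_pos[OF S_pos, of z] A by (intro mult_left_mono) auto
    also have "\<dots> = a * (ratio (S z) * D)" by simp
    finally have "- 2 * ratio' (S z) * (B + z * D)\<^sup>2 < ratio (S z) * D"
      using a by (simp only: mult_less_cancel_left_pos)
    then show ?thesis by (simp add: g2_def power2_eq_square algebra_simps)
  qed
  then obtain d where d: "0 < d" "\<And>h. 0 < h \<Longrightarrow> h < d \<Longrightarrow> g1 (z + h) < g1 z"
    using DERIV_neg_dec_right[OF g1_deriv] by blast
  define e where "e = min (d / 2) (1 - z)"
  have e: "0 < e" "e < d" "z + e \<le> 1" using d z01 by (auto simp: e_def min_def)
  have "g (z + e) < g z"
  proof (rule DERIV_neg_imp_decreasing_open[where f = g and a = z and b = "z + e"])
    fix x assume x: "z < x" "x < z + e"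
    show "\<exists>y. DERIV g x :> y \<and> y < 0"
      using d(2)[of "x - z"] x e \<open>g1 z = 0\<close> g_deriv[of x] by auto
  qed (use e g_deriv in \<open>auto intro!: continuous_at_imp_continuous_on DERIV_isCont\<close>)
  then show False using z(2)[of "z + e"] e z01 by simp
qed

section \<open>Convexity and concavity along rays\<close>

definition \<Phi> :: "real \<Rightarrow> real" where "\<Phi> r = - ln (gig_int a \<nu> (r\<^sup>2))"

lemma \<Phi>_deriv:
  assumes r: "0 < r"
  shows "(\<Phi> has_real_derivative slope r) (at r)"
proof -
  have "((\<lambda>r. ln (gig_int a \<nu> (r\<^sup>2))) has_real_derivative - ratio (r\<^sup>2) / 2 * (2 * r)) (at r)"
    by (rule DERIV_chain2[where f = "\<lambda>s. ln (gig_int a \<nu> s)" and g = "\<lambda>r. r\<^sup>2", OF ln_G_deriv]) (use r in \<open>auto intro!: derivative_eq_intros\<close>)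
  from DERIV_minus[OF this] show ?thesis
    unfolding \<Phi>_def[abs_def] slope_def by (simp add: mult.commute)
qed

lemma \<Phi>_mono:
  assumes "0 < r" "r \<le> r'"
  shows "\<Phi> r \<le> \<Phi> r'"
  by (rule DERIV_nonneg_mono[OF assms(2), where f' = slope])
     (use assms in \<open>auto intro!: \<Phi>_deriv less_imp_le[OF y_pos]\<close>)

lemma \<Phi>_convex: "1 / 2 \<le> \<nu> \<Longrightarrow> convex_on {0<..} \<Phi>"
  by (rule f''_ge0_imp_convex[OF _ \<Phi>_deriv y_deriv']) (auto intro: Y_nonneg)

lemma \<Phi>_concave: "\<nu> \<le> 1 / 2 \<Longrightarrow> concave_on {0<..} \<Phi>"
  by (rule f''_le0_imp_concave[OF _ \<Phi>_deriv y_deriv']) (auto intro: Y_nonpos')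

lemma ray_deriv:
  assumes "0 < chi + t\<^sup>2"
  shows "((\<lambda>t. A * t + ln (gig_int a \<nu> (chi + t\<^sup>2))) has_real_derivative A - t * ratio (chi + t\<^sup>2)) (at t)"
proof -
  have "((\<lambda>t. ln (gig_int a \<nu> (chi + t\<^sup>2))) has_real_derivative - ratio (chi + t\<^sup>2) / 2 * (2 * t)) (at t)"
    by (rule DERIV_chain2[where f = "\<lambda>s. ln (gig_int a \<nu> s)" and g = "\<lambda>t. chi + t\<^sup>2", OF ln_G_deriv[OF assms]]) (auto intro!: derivative_eq_intros)
  from DERIV_add[OF DERIV_cmult[OF DERIV_ident, of A] this] show ?thesis by (simp add: mult.commute)
qed

text \<open>Concavity would make \<open>t * ratio (chi + t\<^sup>2)\<close> nondecreasing, which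
  \<open>not_mono_slope\<close> excludes.\<close>

lemma ray_not_concave:
  assumes \<nu>: "\<nu> < 1 / 2" and chi: "0 \<le> chi"
  shows "\<not> concave_on {0<..} (\<lambda>t. A * t + ln (gig_int a \<nu> (chi + t\<^sup>2)))"
proof
  assume conc: "concave_on {0<..} (\<lambda>t. A * t + ln (gig_int a \<nu> (chi + t\<^sup>2)))"
  show False
  proof (rule not_mono_slope[OF _ Y_nonpos' slope_le _ chi])
    fix s t :: real assume st: "0 < s" "s \<le> t"
    have "- (A - s * ratio (chi + s\<^sup>2)) \<le> - (A - t * ratio (chi + t\<^sup>2))"
    proof (rule convex_on_deriv_mono[OF conc[unfolded concave_on_def] _ st])
      fix t :: real assume "0 < t"
      then show "((\<lambda>t. - (A * t + ln (gig_int a \<nu> (chi + t\<^sup>2)))) has_real_derivative - (A - t * ratio (chi + t\<^sup>2))) (at t)"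
        using chi by (intro DERIV_minus ray_deriv) (simp add: add_nonneg_pos)
    qed
    moreover have "x * slope (sqrt (chi + x\<^sup>2)) / sqrt (chi + x\<^sup>2) = x * ratio (chi + x\<^sup>2)" if "0 < x" for x
    proof -
      have "0 < chi + x\<^sup>2" using that chi by (simp add: add_nonneg_pos)
      then show ?thesis by (simp add: slope_def)
    qed
    ultimately show "s * slope (sqrt (chi + s\<^sup>2)) / sqrt (chi + s\<^sup>2) \<le> t * slope (sqrt (chi + t\<^sup>2)) / sqrt (chi + t\<^sup>2)"
      using st by simp
  qed (use \<nu> in auto)
qed

text \<open>Convexity makes \<open>t * ratio (chi + t\<^sup>2)\<close> nonincreasing. For
  \<open>chi > 0\<close> this positive function tends to 0 at 0, which is absurd. For
  \<open>chi = 0\<close> it is \<open>slope\<close>, which for \<open>\<nu> > 1 / 2\<close> is also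
  nondecreasing, hence constant.\<close>

lemma ray_convex_imp:
  assumes chi: "0 \<le> chi" and conv: "convex_on {0<..} (\<lambda>t. A * t + ln (gig_int a \<nu> (chi + t\<^sup>2)))"
  shows "chi = 0 \<and> \<nu> \<le> 1 / 2"
proof -
  have anti: "t * ratio (chi + t\<^sup>2) \<le> s * ratio (chi + s\<^sup>2)" if st: "0 < s" "s \<le> t" for s t
  proof -
    have "A - s * ratio (chi + s\<^sup>2) \<le> A - t * ratio (chi + t\<^sup>2)"
      by (rule convex_on_deriv_mono[OF conv ray_deriv st]) (use chi in \<open>simp add: add_nonneg_pos\<close>)
    then show ?thesis by simp
  qed
  have "chi = 0"
  proof (rule ccontr)
    assume "chi \<noteq> 0"
    with chi have chi: "0 < chi" by simp
    have "isCont (\<lambda>t. t * ratio (chi + t\<^sup>2)) 0"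
      by (intro continuous_intros isCont_o2[of _ "\<lambda>t. chi + t\<^sup>2" ratio] DERIV_isCont[OF ratio_deriv])
         (use chi in auto)
    then have "((\<lambda>t. t * ratio (chi + t\<^sup>2)) \<longlongrightarrow> 0) (at_right 0)"
      using filterlim_at_split by (force simp: isCont_def)
    moreover have "eventually (\<lambda>t. 1 * ratio (chi + 1\<^sup>2) \<le> t * ratio (chi + t\<^sup>2)) (at_right 0)"
      unfolding eventually_at_right_field using anti[of _ 1] by (intro exI[of _ 1]) auto
    ultimately have "1 * ratio (chi + 1\<^sup>2) \<le> 0"
      by (rule tendsto_lowerbound) simp
    then show False using ratio_pos[of "chi + 1"] chi by simp
  qed
  moreover have "\<nu> \<le> 1 / 2"
  proof (rule ccontr)
    assume \<nu>: "\<not> \<nu> \<le> 1 / 2"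
    have slope_anti: "slope t \<le> slope s" if "0 < s" "s \<le> t" for s t
      using anti[OF that] \<open>chi = 0\<close> by (simp add: slope_def)
    have Y0: "Y r = 0" if r: "0 < r" for r
    proof (rule ccontr)
      assume "Y r \<noteq> 0"
      with \<nu> r Y_nonneg[of r] have "0 < Y r" by simp
      then obtain d where d: "0 < d" "\<And>h. 0 < h \<Longrightarrow> h < d \<Longrightarrow> slope r < slope (r + h)"
        using DERIV_pos_inc_right[OF y_deriv'[OF r]] by blast
      have "slope r < slope (r + d / 2)" using d(1) by (intro d(2)) auto
      with slope_anti[OF r, of "r + d / 2"] d(1) show False by simp
    qed
    have "slope 1 \<le> slope 2"
    proof (rule DERIV_nonneg_mono[where f = slope and f' = Y])
      fix t :: real assume "1 \<le> t"
      then show "(slope has_real_derivative Y t) (at t)" "0 \<le> Y t"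
        using y_deriv'[of t] Y0[of t] by simp_all
    qed simp
    then have "slope 2 = slope 1" using slope_anti[of 1 2] by simp
    \<comment> \<open>A constant solution must satisfy the equation at both 1 and 2, and only the
      term in 1/r differs.\<close>
    then have "(slope 1)\<^sup>2 - a + (2 * \<nu> - 1) * slope 1 = 0" "(slope 1)\<^sup>2 - a + (2 * \<nu> - 1) * slope 1 / 2 = 0"
      using Y0[of 1] Y0[of 2] by (simp_all add: Y_def)
    then have "(2 * \<nu> - 1) * slope 1 = 0" by linarith
    then show False using \<nu> y_pos[of 1] by simp
  qed
  ultimately show ?thesis ..
qed

end

section \<open>Shape of the mixture density\<close>

text \<open>The density in the coordinate \<open>u\<close>, over a general inner product space. The
  bound on \<open>\<gamma>\<close> holds because there \<open>a\<close> is
  \<open>psi + (norm \<gamma>)\<^sup>2\<close>.\<close>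

locale gig_mixture = gig_integral a \<nu> for a \<nu> :: real +
  fixes C :: real and \<gamma> :: "'a::real_inner"
  assumes C: "0 < C" and \<gamma>: "(norm \<gamma>)\<^sup>2 \<le> a"
begin

definition h :: "real \<Rightarrow> 'a \<Rightarrow> ennreal" where
  "h chi u = ennreal (C * exp (u \<bullet> \<gamma>)) * gig_nn a \<nu> (chi + (norm u)\<^sup>2)"

text \<open>The logarithm of \<open>h\<close> wherever \<open>chi + (norm u)\<^sup>2 > 0\<close>; at
  \<open>u = 0\<close> with \<open>chi = 0\<close> the density itself may be infinite.\<close>

definition L :: "real \<Rightarrow> 'a \<Rightarrow> real" where
  "L chi u = ln C + u \<bullet> \<gamma> + ln (gig_int a \<nu> (chi + (norm u)\<^sup>2))"

lemma h_eq_int: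
  assumes "0 \<le> chi + (norm u)\<^sup>2" "0 < chi + (norm u)\<^sup>2 \<or> 0 < \<nu>"
  shows "h chi u = ennreal (C * exp (u \<bullet> \<gamma>) * gig_int a \<nu> (chi + (norm u)\<^sup>2))"
    and "0 < C * exp (u \<bullet> \<gamma>) * gig_int a \<nu> (chi + (norm u)\<^sup>2)"
  using gig_nn_eq[OF assms(1) a0 assms(2) a_cases] gig_int_pos[OF assms(1) a0 assms(2) a_cases] C
  by (auto simp: h_def ennreal_mult)

lemma h_eq:
  assumes "0 < chi + (norm u)\<^sup>2"
  shows "h chi u = ennreal (exp (L chi u))"
  using h_eq_int[of chi u] assms G_pos[OF assms] C by (simp add: L_def exp_add)

lemma h_tendsto: "(\<lambda>n. h (chi + 1 / real (Suc n)) u) \<longlonglongrightarrow> h chi u"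
proof -
  have "(\<lambda>n. ennreal (C * exp (u \<bullet> \<gamma>)) * gig_nn a \<nu> (chi + (norm u)\<^sup>2 + 1 / real (Suc n)))
      \<longlonglongrightarrow> ennreal (C * exp (u \<bullet> \<gamma>)) * gig_nn a \<nu> (chi + (norm u)\<^sup>2)"
    by (intro ennreal_tendsto_cmult gig_nn_tendsto) simp
  then show ?thesis by (simp add: h_def add_ac)
qed

section \<open>Convex contours and log-concavity\<close>

lemma L_concave:
  assumes \<nu>: "1 / 2 \<le> \<nu>" and chi: "0 < chi" and \<theta>: "0 \<le> \<theta>" "\<theta> \<le> 1"
  shows "(1 - \<theta>) * L chi x + \<theta> * L chi z \<le> L chi ((1 - \<theta>) *\<^sub>R x + \<theta> *\<^sub>R z)"
proof -
  \<comment> \<open>The function sqrt(chi + |u|^2) is a norm in the product space, hence convex in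
    \<open>u\<close>; composing it with the increasing convex \<open>\<Phi>\<close> keeps
    convexity.\<close>
  define w where "w u = norm (sqrt chi, u)" for u :: 'a
  have w: "0 < w u" "w u ^ 2 = chi + (norm u)\<^sup>2" for u
    using chi by (auto simp: w_def norm_Pair intro: add_pos_nonneg)
  have L_eq: "L chi u = ln C + u \<bullet> \<gamma> - \<Phi> (w u)" for u
    by (simp add: L_def \<Phi>_def w(2))
  have "(sqrt chi, (1 - \<theta>) *\<^sub>R x + \<theta> *\<^sub>R z) = (1 - \<theta>) *\<^sub>R (sqrt chi, x) + \<theta> *\<^sub>R (sqrt chi, z)"
    by (simp add: algebra_simps)
  then have "w ((1 - \<theta>) *\<^sub>R x + \<theta> *\<^sub>R z) \<le> (1 - \<theta>) * w x + \<theta> * w z"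
    unfolding w_def using \<theta> by (metis abs_of_nonneg diff_ge_0_iff_ge norm_scaleR norm_triangle_ineq)
  then have "\<Phi> (w ((1 - \<theta>) *\<^sub>R x + \<theta> *\<^sub>R z)) \<le> \<Phi> ((1 - \<theta>) * w x + \<theta> * w z)"
    by (rule \<Phi>_mono[OF w(1)])
  also have "\<dots> \<le> (1 - \<theta>) * \<Phi> (w x) + \<theta> * \<Phi> (w z)"
    using convex_onD[OF \<Phi>_convex[OF \<nu>], of \<theta> "w x" "w z"] \<theta> w(1) by simp
  finally show ?thesis by (simp add: L_eq inner_add_left algebra_simps)
qed

text \<open>Restriction to the segment from \<open>x\<close> to \<open>z\<close> gives the form
  treated in \<open>line_quasi_concave\<close>, and Cauchy-Schwarz with the bound on
  \<open>\<gamma>\<close> gives its hypothesis on \<open>A\<close>.\<close>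

lemma L_quasi_concave:
  assumes \<nu>: "\<nu> < 1 / 2" and a: "0 < a" and chi: "0 < chi" and \<theta>: "0 \<le> \<theta>" "\<theta> \<le> 1"
  shows "min (L chi x) (L chi z) \<le> L chi ((1 - \<theta>) *\<^sub>R x + \<theta> *\<^sub>R z)"
proof (cases "x = z")
  case True
  then have "(1 - \<theta>) *\<^sub>R x + \<theta> *\<^sub>R z = x" by (simp add: algebra_simps)
  then show ?thesis by simp
next
  case False
  define d where "d = z - x"
  have point: "(1 - t) *\<^sub>R x + t *\<^sub>R z = x + t *\<^sub>R d" for t by (simp add: d_def algebra_simps)
  have s: "chi + (norm x)\<^sup>2 + 2 * t * (x \<bullet> d) + t\<^sup>2 * (d \<bullet> d) = chi + (norm (x + t *\<^sub>R d))\<^sup>2" for t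
    unfolding power2_norm_eq_inner
    by (simp add: inner_add_left inner_add_right inner_commute power2_eq_square)
  have "(d \<bullet> \<gamma>)\<^sup>2 \<le> (d \<bullet> d) * (\<gamma> \<bullet> \<gamma>)" by (rule Cauchy_Schwarz_ineq)
  also have "\<dots> \<le> (d \<bullet> d) * a" using \<gamma> by (intro mult_left_mono) (auto simp: power2_norm_eq_inner)
  finally have A: "(d \<bullet> \<gamma>)\<^sup>2 \<le> a * (d \<bullet> d)" by (simp add: mult.commute)
  have "min (0 * (d \<bullet> \<gamma>) + ln (gig_int a \<nu> (chi + (norm x)\<^sup>2 + 2 * 0 * (x \<bullet> d) + 0\<^sup>2 * (d \<bullet> d))))
      (1 * (d \<bullet> \<gamma>) + ln (gig_int a \<nu> (chi + (norm x)\<^sup>2 + 2 * 1 * (x \<bullet> d) + 1\<^sup>2 * (d \<bullet> d))))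
      \<le> \<theta> * (d \<bullet> \<gamma>) + ln (gig_int a \<nu> (chi + (norm x)\<^sup>2 + 2 * \<theta> * (x \<bullet> d) + \<theta>\<^sup>2 * (d \<bullet> d)))"
  proof (rule line_quasi_concave[OF \<nu> a _ A _ \<theta>])
    show "0 < d \<bullet> d" using False by (simp add: d_def)
    show "0 < chi + (norm x)\<^sup>2 + 2 * t * (x \<bullet> d) + t\<^sup>2 * (d \<bullet> d)" for t
      unfolding s using chi by (simp add: add_pos_nonneg)
  qed
  moreover have "x + 1 *\<^sub>R d = z" by (simp add: d_def)
  ultimately show ?thesis
    unfolding point s L_def by (simp add: inner_add_left d_def inner_diff_left min_def split: if_splits)
qed

text \<open>Proved for positive parameters, where \<open>h\<close> is finite, and carried to
  \<open>chi\<close> by letting \<open>chi + 1 / real (Suc n)\<close> decrease; infinite values do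
  no harm.\<close>

lemma h_quasi_concave:
  assumes a: "0 < a" and chi: "0 \<le> chi" and \<theta>: "0 \<le> \<theta>" "\<theta> \<le> 1"
  shows "min (h chi x) (h chi z) \<le> h chi ((1 - \<theta>) *\<^sub>R x + \<theta> *\<^sub>R z)"
proof (rule LIMSEQ_le)
  show "(\<lambda>n. min (h (chi + 1 / real (Suc n)) x) (h (chi + 1 / real (Suc n)) z)) \<longlonglongrightarrow> min (h chi x) (h chi z)"
    by (intro tendsto_min h_tendsto)
  show "(\<lambda>n. h (chi + 1 / real (Suc n)) ((1 - \<theta>) *\<^sub>R x + \<theta> *\<^sub>R z)) \<longlonglongrightarrow> h chi ((1 - \<theta>) *\<^sub>R x + \<theta> *\<^sub>R z)"
    by (rule h_tendsto)
  have "min (h c x) (h c z) \<le> h c ((1 - \<theta>) *\<^sub>R x + \<theta> *\<^sub>R z)" if c: "0 < c" for c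
  proof -
    have "min (L c x) (L c z) \<le> L c ((1 - \<theta>) *\<^sub>R x + \<theta> *\<^sub>R z)"
    proof (cases "\<nu> < 1 / 2")
      case True
      then show ?thesis by (rule L_quasi_concave[OF _ a c \<theta>])
    next
      case False
      have "min (L c x) (L c z) = (1 - \<theta>) * min (L c x) (L c z) + \<theta> * min (L c x) (L c z)"
        by (simp add: algebra_simps)
      also have "\<dots> \<le> (1 - \<theta>) * L c x + \<theta> * L c z"
        using \<theta> by (intro add_mono mult_left_mono) auto
      also have "\<dots> \<le> L c ((1 - \<theta>) *\<^sub>R x + \<theta> *\<^sub>R z)"
        using False by (intro L_concave c \<theta>) auto
      finally show ?thesis .
    qed
    then show ?thesis
      using c by (auto simp: h_eq add_pos_nonneg min_le_iff_disj)
  qed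
  then show "\<exists>N. \<forall>n\<ge>N. min (h (chi + 1 / real (Suc n)) x) (h (chi + 1 / real (Suc n)) z)
      \<le> h (chi + 1 / real (Suc n)) ((1 - \<theta>) *\<^sub>R x + \<theta> *\<^sub>R z)"
    using chi by (auto simp: add_nonneg_pos)
qed

lemma h_convex_contours:
  assumes chi: "0 \<le> chi"
  shows "convex_contours (h chi)"
proof -
  have "min (h chi x) (h chi z) \<le> h chi ((1 - \<theta>) *\<^sub>R x + \<theta> *\<^sub>R z)" if \<theta>: "0 \<le> \<theta>" "\<theta> \<le> 1" for x z \<theta>
  proof (cases "0 < a")
    case True
    then show ?thesis by (rule h_quasi_concave[OF _ chi \<theta>])
  next
    case False
    \<comment> \<open>With \<open>a = 0\<close> the exponential factor is constant, and
      \<open>h\<close> is a nonincreasing function of the norm.\<close>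
    then have \<gamma>0: "\<gamma> = 0" using \<gamma> a0 by simp
    have "norm ((1 - \<theta>) *\<^sub>R x + \<theta> *\<^sub>R z) \<le> (1 - \<theta>) * norm x + \<theta> * norm z"
      using \<theta> by (metis abs_of_nonneg diff_ge_0_iff_ge norm_scaleR norm_triangle_ineq)
    also have "\<dots> \<le> (1 - \<theta>) * max (norm x) (norm z) + \<theta> * max (norm x) (norm z)"
      using \<theta> by (intro add_mono mult_left_mono) auto
    also have "\<dots> = max (norm x) (norm z)" by (simp add: algebra_simps)
    finally have "norm ((1 - \<theta>) *\<^sub>R x + \<theta> *\<^sub>R z) \<le> norm x \<or> norm ((1 - \<theta>) *\<^sub>R x + \<theta> *\<^sub>R z) \<le> norm z"
      by (simp add: le_max_iff_disj)
    moreover have "h chi u \<le> h chi v" if "norm v \<le> norm u" for u v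
      unfolding h_def using that by (auto simp: \<gamma>0 intro!: mult_left_mono gig_nn_antimono power_mono)
    ultimately show ?thesis by (auto simp: min_le_iff_disj)
  qed
  then have "c \<le> h chi ((1 - \<theta>) *\<^sub>R x + \<theta> *\<^sub>R z)"
    if "c \<le> h chi x" "c \<le> h chi z" "0 \<le> \<theta>" "\<theta> \<le> 1" for c x z \<theta>
    using that by (meson min.boundedI order_trans)
  then show ?thesis
    unfolding convex_contours_def convex_alt by blast
qed

lemma h_log_concave:
  assumes \<nu>: "1 / 2 \<le> \<nu>" and chi: "0 \<le> chi"
  shows "log_concave_fun (h chi)"
  unfolding log_concave_fun_def
proof (intro allI ballI)
  fix x z :: 'a and \<theta> :: real
  assume "\<theta> \<in> {0<..<1}"
  then have \<theta>: "0 < \<theta>" "\<theta> < 1" by auto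
  \<comment> \<open>The condition on \<open>\<nu>\<close> makes the density finite even at
    \<open>u = 0\<close> with \<open>chi = 0\<close>, so the limit in \<open>chi\<close> can be
    taken among positive reals, where \<open>powr\<close> is continuous.\<close>
  define k where "k c u = C * exp (u \<bullet> \<gamma>) * gig_int a \<nu> (c + (norm u)\<^sup>2)" for c u
  have hk: "h c u = ennreal (k c u)" "0 < k c u" if "0 \<le> c" for c u
    using that \<nu> h_eq_int[of c u] by (auto simp: k_def)
  have lim: "(\<lambda>n. k (chi + 1 / real (Suc n)) u) \<longlonglongrightarrow> k chi u" for u
  proof -
    have "(\<lambda>n. gig_int a \<nu> (chi + (norm u)\<^sup>2 + 1 / real (Suc n))) \<longlonglongrightarrow> gig_int a \<nu> (chi + (norm u)\<^sup>2)"
      using chi \<nu> a0 a_cases by (intro gig_int_tendsto) auto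
    then show ?thesis
      unfolding k_def by (intro tendsto_mult tendsto_const) (simp add: add_ac)
  qed
  have "k chi x powr \<theta> * k chi z powr (1 - \<theta>) \<le> k chi (\<theta> *\<^sub>R x + (1 - \<theta>) *\<^sub>R z)"
  proof (rule LIMSEQ_le)
    show "(\<lambda>n. k (chi + 1 / real (Suc n)) x powr \<theta> * k (chi + 1 / real (Suc n)) z powr (1 - \<theta>))
        \<longlonglongrightarrow> k chi x powr \<theta> * k chi z powr (1 - \<theta>)"
      using hk(2)[OF chi, of x] hk(2)[OF chi, of z] by (intro tendsto_mult tendsto_powr lim tendsto_const) auto
    show "(\<lambda>n. k (chi + 1 / real (Suc n)) (\<theta> *\<^sub>R x + (1 - \<theta>) *\<^sub>R z)) \<longlonglongrightarrow> k chi (\<theta> *\<^sub>R x + (1 - \<theta>) *\<^sub>R z)"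
      by (rule lim)
    have "k c x powr \<theta> * k c z powr (1 - \<theta>) \<le> k c (\<theta> *\<^sub>R x + (1 - \<theta>) *\<^sub>R z)" if c: "0 < c" for c
    proof -
      have kL: "k c u = exp (L c u)" for u
        using h_eq[of c u] hk[of c u] c by (simp add: add_pos_nonneg ennreal_inj)
      have "\<theta> * L c x + (1 - \<theta>) * L c z \<le> L c (\<theta> *\<^sub>R x + (1 - \<theta>) *\<^sub>R z)"
        using L_concave[OF \<nu> c, of "1 - \<theta>" x z] \<theta> by simp
      then show ?thesis by (simp add: kL powr_def exp_add[symmetric])
    qed
    then show "\<exists>N. \<forall>n\<ge>N. k (chi + 1 / real (Suc n)) x powr \<theta> * k (chi + 1 / real (Suc n)) z powr (1 - \<theta>)
        \<le> k (chi + 1 / real (Suc n)) (\<theta> *\<^sub>R x + (1 - \<theta>) *\<^sub>R z)"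
      using chi by (auto simp: add_nonneg_pos)
  qed
  then show "epowr (h chi x) \<theta> * epowr (h chi z) (1 - \<theta>) \<le> h chi (\<theta> *\<^sub>R x + (1 - \<theta>) *\<^sub>R z)"
    using hk[OF chi] by (simp add: epowr_def less_imp_le ennreal_mult[symmetric] ennreal_leI)
qed

lemma ray_pos: "0 \<le> chi \<Longrightarrow> norm e = 1 \<Longrightarrow> 0 < t \<Longrightarrow> 0 < chi + (norm (t *\<^sub>R e))\<^sup>2"
  by (simp add: add_nonneg_pos)

lemma L_ray: "norm e = 1 \<Longrightarrow> L chi (t *\<^sub>R e) = ln C + ((e \<bullet> \<gamma>) * t + ln (gig_int a \<nu> (chi + t\<^sup>2)))"
  by (simp add: L_def mult.commute power_mult_distrib)

lemma h_not_log_concave: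
  fixes e :: 'a
  assumes \<nu>: "\<nu> < 1 / 2" and chi: "0 \<le> chi" and e: "norm e = 1"
  shows "\<not> log_concave_fun (h chi)"
proof
  assume lc: "log_concave_fun (h chi)"
  define F where "F t = (e \<bullet> \<gamma>) * t + ln (gig_int a \<nu> (chi + t\<^sup>2))" for t
  have hF: "h chi (t *\<^sub>R e) = ennreal (exp (ln C + F t))" if "0 < t" for t
    using h_eq[OF ray_pos[OF chi e that]] L_ray[OF e, of chi t] by (simp add: F_def)
  have "\<theta> * F s + (1 - \<theta>) * F t \<le> F (\<theta> * s + (1 - \<theta>) * t)"
    if \<theta>: "0 < \<theta>" "\<theta> < 1" and st: "0 < s" "0 < t" for \<theta> s t
  proof -
    have pos: "0 < \<theta> * s + (1 - \<theta>) * t" using \<theta> st by (intro add_pos_pos mult_pos_pos) auto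
    have "epowr (h chi (s *\<^sub>R e)) \<theta> * epowr (h chi (t *\<^sub>R e)) (1 - \<theta>) \<le> h chi ((\<theta> * s + (1 - \<theta>) * t) *\<^sub>R e)"
      using lc[unfolded log_concave_fun_def, rule_format, of \<theta> "s *\<^sub>R e" "t *\<^sub>R e"] \<theta>
      by (simp add: scaleR_add_left)
    then have "exp (\<theta> * (ln C + F s)) * exp ((1 - \<theta>) * (ln C + F t)) \<le> exp (ln C + F (\<theta> * s + (1 - \<theta>) * t))"
      unfolding hF[OF st(1)] hF[OF st(2)] hF[OF pos]
      by (simp add: epowr_def powr_def ennreal_mult[symmetric])
    then show ?thesis by (simp add: exp_add[symmetric] algebra_simps)
  qed
  then have "concave_on {0<..} F"
    unfolding concave_on_def
    by (intro convex_onI) (auto simp: algebra_simps)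
  with ray_not_concave[OF \<nu> chi] show False unfolding F_def[abs_def] by blast
qed

text \<open>For \<open>chi = 0\<close> the argument of \<open>\<Phi>\<close> along the ray is the
  linear function \<open>t * norm v\<close>, and \<open>\<Phi>\<close> is concave.\<close>

lemma h_log_convex_ray:
  assumes \<nu>: "\<nu> \<le> 1 / 2" and v: "v \<noteq> 0"
  shows "log_convex_fun_on {0<..} (\<lambda>t. h 0 (t *\<^sub>R v))"
proof -
  have hL: "h 0 (t *\<^sub>R v) = ennreal (exp (L 0 (t *\<^sub>R v)))" if "0 < t" for t
    using that v by (intro h_eq) simp
  have L_eq: "L 0 (t *\<^sub>R v) = ln C + t * (v \<bullet> \<gamma>) - \<Phi> (t * norm v)" if "0 < t" for t
    using that by (simp add: L_def \<Phi>_def power_mult_distrib)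
  then have ln_h: "ln (enn2real (h 0 (t *\<^sub>R v))) = ln C + t * (v \<bullet> \<gamma>) - \<Phi> (t * norm v)" if "0 < t" for t
    using that by (simp add: hL)
  have conc: "u * \<Phi> (s * norm v) + w * \<Phi> (t * norm v) \<le> \<Phi> ((u * s + w * t) * norm v)"
    if "0 < s" "0 < t" "0 \<le> u" "0 \<le> w" "u + w = 1" for s t u w
  proof -
    have "u * \<Phi> (s * norm v) + w * \<Phi> (t * norm v) \<le> \<Phi> (u *\<^sub>R (s * norm v) + w *\<^sub>R (t * norm v))"
      using \<Phi>_concave[OF \<nu>] that v unfolding concave_on_iff by simp
    then show ?thesis by (simp add: algebra_simps)
  qed
  have "convex_on {0<..} (\<lambda>t. ln (enn2real (h 0 (t *\<^sub>R v))))"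
    unfolding convex_on_def
  proof (intro conjI ballI allI impI)
    fix s t u w :: real
    assume st: "s \<in> {0<..}" "t \<in> {0<..}" and uw: "0 \<le> u" "0 \<le> w" "u + w = 1"
    have pos: "0 < u * s + w * t"
      using st uw by (cases "u = 0") (auto intro!: add_pos_nonneg)
    have lnC: "u * ln C + w * ln C = ln C" using uw by (simp add: distrib_right[symmetric])
    have "0 < s" "0 < t" using st by auto
    then show "ln (enn2real (h 0 ((u *\<^sub>R s + w *\<^sub>R t) *\<^sub>R v)))
        \<le> u * ln (enn2real (h 0 (s *\<^sub>R v))) + w * ln (enn2real (h 0 (t *\<^sub>R v)))"
      using conc[OF _ _ uw, of s t] lnC
      unfolding real_scaleR_def ln_h[OF pos] ln_h[OF \<open>0 < s\<close>] ln_h[OF \<open>0 < t\<close>]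
      by (simp add: algebra_simps)
  qed simp
  then show ?thesis by (simp add: log_convex_fun_on_def hL)
qed

lemma h_log_convex_ray_imp:
  fixes e :: 'a
  assumes chi: "0 \<le> chi" and e: "norm e = 1"
    and conv: "log_convex_fun_on {0<..} (\<lambda>t. h chi (t *\<^sub>R e))"
  shows "chi = 0 \<and> \<nu> \<le> 1 / 2"
proof -
  define F where "F t = (e \<bullet> \<gamma>) * t + ln (gig_int a \<nu> (chi + t\<^sup>2))" for t
  have hF: "ln (enn2real (h chi (t *\<^sub>R e))) = ln C + F t" if "0 < t" for t
    using h_eq[OF ray_pos[OF chi e that]] L_ray[OF e, of chi t] by (simp add: F_def)
  have "convex_on {0<..} (\<lambda>t. ln (enn2real (h chi (t *\<^sub>R e))))"
    using conv by (simp add: log_convex_fun_on_def)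
  then have "convex_on {0<..} (\<lambda>t. ln C + F t)"
    unfolding convex_on_def
  proof (elim conjE, intro conjI ballI allI impI)
    fix s t u w :: real
    assume conv: "\<forall>x\<in>{0<..}. \<forall>y\<in>{0<..}. \<forall>u\<ge>0. \<forall>v\<ge>0. u + v = 1 \<longrightarrow>
        ln (enn2real (h chi ((u *\<^sub>R x + v *\<^sub>R y) *\<^sub>R e)))
        \<le> u * ln (enn2real (h chi (x *\<^sub>R e))) + v * ln (enn2real (h chi (y *\<^sub>R e)))"
      and st: "s \<in> {0<..}" "t \<in> {0<..}" and uw: "0 \<le> u" "0 \<le> w" "u + w = 1"
    have "u *\<^sub>R s + w *\<^sub>R t \<in> {0<..}"
      by (rule convexD) (use st uw in auto)
    then show "ln C + F (u *\<^sub>R s + w *\<^sub>R t) \<le> u * (ln C + F s) + w * (ln C + F t)"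
      using conv[rule_format, of s t u w] st uw by (simp add: hF)
  qed
  then have "convex_on {0<..} F"
    using convex_on_add[of "{0<..}" "\<lambda>t. ln C + F t" "\<lambda>_. - ln C"] by (simp add: convex_on_const)
  then show ?thesis using ray_convex_imp[OF chi] by (simp add: F_def[abs_def])
qed

section \<open>Location of the maximum\<close>

lemma h_ray_tendsto:
  fixes e :: 'a
  assumes "norm e = 1"
  shows "(\<lambda>n. h chi (sqrt (1 / real (Suc n)) *\<^sub>R e)) \<longlonglongrightarrow> h chi 0"
proof -
  \<comment> \<open>The radii are chosen so that their squares are \<open>1 / real (Suc n)\<close>,
    the sequence of \<open>gig_nn_tendsto\<close>. An infinite value at 0 is thereby reached as
    well.\<close>
  have lim: "(\<lambda>n. sqrt (1 / real (Suc n))) \<longlonglongrightarrow> sqrt 0"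
    using LIMSEQ_inverse_real_of_nat by (intro tendsto_real_sqrt) (simp add: inverse_eq_divide)
  have 1: "(\<lambda>n. ennreal (C * exp (sqrt (1 / real (Suc n)) * (e \<bullet> \<gamma>)))) \<longlonglongrightarrow> ennreal (C * exp (sqrt 0 * (e \<bullet> \<gamma>)))"
    by (intro tendsto_ennrealI tendsto_intros lim)
  have "(\<lambda>n. ennreal (C * exp (sqrt (1 / real (Suc n)) * (e \<bullet> \<gamma>))) * gig_nn a \<nu> (chi + 1 / real (Suc n)))
      \<longlonglongrightarrow> ennreal (C * exp (sqrt 0 * (e \<bullet> \<gamma>))) * gig_nn a \<nu> chi"
    by (rule tendsto_mult_ennreal[OF 1 gig_nn_tendsto]) (use C in simp)
  then show ?thesis using assms by (simp add: h_def power_mult_distrib)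
qed

lemma ray_seq_small: "0 < t \<Longrightarrow> \<exists>N. \<forall>n\<ge>N. sqrt (1 / real (Suc n)) < t"
proof -
  assume t: "0 < t"
  have "(\<lambda>n. sqrt (1 / real (Suc n))) \<longlonglongrightarrow> sqrt 0"
    using LIMSEQ_inverse_real_of_nat by (intro tendsto_real_sqrt) (simp add: inverse_eq_divide)
  then show ?thesis
    using order_tendstoD(2)[of _ 0 sequentially t] t by (simp add: eventually_sequentially)
qed

text \<open>In any unit direction \<open>e\<close> the logarithmic derivative is
  \<open>e \<bullet> \<gamma> - t * ratio (chi + t\<^sup>2)\<close>, and \<open>steep\<close> makes
  it negative.\<close>

lemma h_max_at_0:
  assumes chi: "0 \<le> chi" and steep: "\<And>t. 0 < t \<Longrightarrow> norm \<gamma> < t * ratio (chi + t\<^sup>2)" and u: "u \<noteq> 0"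
  shows "h chi u < h chi 0"
proof -
  define e where "e = u /\<^sub>R norm u"
  have e: "norm e = 1" using u by (simp add: e_def)
  define F where "F t = (e \<bullet> \<gamma>) * t + ln (gig_int a \<nu> (chi + t\<^sup>2))" for t
  have hF: "h chi (t *\<^sub>R e) = ennreal (exp (ln C + F t))" if "0 < t" for t
    using h_eq[OF ray_pos[OF chi e that]] L_ray[OF e, of chi t] by (simp add: F_def)
  have decr: "F t < F s" if st: "0 < s" "s < t" for s t
  proof (rule DERIV_neg_imp_decreasing[OF st(2)])
    fix x assume "s \<le> x"
    with st have x: "0 < x" by simp
    have "e \<bullet> \<gamma> \<le> norm \<gamma>" using norm_cauchy_schwarz[of e \<gamma>] e by simp
    then have "e \<bullet> \<gamma> - x * ratio (chi + x\<^sup>2) < 0" using steep[OF x] by simp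
    moreover have "(F has_real_derivative e \<bullet> \<gamma> - x * ratio (chi + x\<^sup>2)) (at x)"
      unfolding F_def[abs_def] by (rule ray_deriv) (use x chi in \<open>simp add: add_nonneg_pos\<close>)
    ultimately show "\<exists>y. (F has_real_derivative y) (at x) \<and> y < 0" by blast
  qed
  define r where "r = norm u"
  have r: "0 < r" "u = r *\<^sub>R e" using u by (auto simp: r_def e_def)
  \<comment> \<open>The intermediate point at half the distance keeps the inequality strict when the
    limit towards 0 is taken.\<close>
  have "h chi u < h chi ((r / 2) *\<^sub>R e)"
    unfolding r(2) using hF[of r] hF[of "r / 2"] decr[of "r / 2" r] r(1) by (simp add: ennreal_less_iff)
  also have "\<dots> \<le> h chi 0"
  proof (rule LIMSEQ_le_const[OF h_ray_tendsto[OF e]])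
    obtain N where N: "\<And>n. n \<ge> N \<Longrightarrow> sqrt (1 / real (Suc n)) < r / 2"
      using ray_seq_small[of "r / 2"] r by auto
    have "h chi ((r / 2) *\<^sub>R e) \<le> h chi (sqrt (1 / real (Suc n)) *\<^sub>R e)" if "n \<ge> N" for n
    proof -
      have "0 < sqrt (1 / real (Suc n))" by simp
      from hF[OF this] decr[OF this N[OF that]] show ?thesis
        using hF[of "r / 2"] r by (simp add: ennreal_leI)
    qed
    then show "\<exists>N. \<forall>n\<ge>N. h chi ((r / 2) *\<^sub>R e) \<le> h chi (sqrt (1 / real (Suc n)) *\<^sub>R e)" by blast
  qed
  finally show ?thesis .
qed

text \<open>In the direction of \<open>\<gamma>\<close> the logarithmic derivative starts positive:
  by continuity at 0 if \<open>chi > 0\<close>, and by \<open>y_small_near_0\<close> with the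
  monotonicity of \<open>slope\<close> otherwise. A weak inequality is enough to refute a unique
  maximizer.\<close>

lemma h_not_max_at_0:
  assumes chi: "0 \<le> chi" and \<gamma>0: "\<gamma> \<noteq> 0" and cases: "0 < chi \<or> 1 / 2 < \<nu>"
  shows "\<exists>u. u \<noteq> 0 \<and> h chi 0 \<le> h chi u"
proof -
  have "\<exists>t0>0. \<forall>t. 0 < t \<longrightarrow> t < t0 \<longrightarrow> t * ratio (chi + t\<^sup>2) < norm \<gamma>"
  proof (cases "0 < chi")
    case True
    have "isCont (\<lambda>t. t * ratio (chi + t\<^sup>2)) 0"
      by (intro continuous_intros isCont_o2[of _ "\<lambda>t. chi + t\<^sup>2" ratio] DERIV_isCont[OF ratio_deriv])
         (use True in auto)
    then have "((\<lambda>t. t * ratio (chi + t\<^sup>2)) \<longlongrightarrow> 0) (at_right 0)"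
      using filterlim_at_split by (force simp: isCont_def)
    then have "eventually (\<lambda>t. t * ratio (chi + t\<^sup>2) < norm \<gamma>) (at_right 0)"
      by (rule order_tendstoD) (use \<gamma>0 in simp)
    then show ?thesis unfolding eventually_at_right_field by auto
  next
    case False
    then have chi0: "chi = 0" and \<nu>: "1 / 2 < \<nu>" using chi cases by auto
    obtain t0 where t0: "0 < t0" "slope t0 < norm \<gamma>"
      using y_small_near_0[of "norm \<gamma>"] \<nu> \<gamma>0 by auto
    have "slope t \<le> slope t0" if "0 < t" "t < t0" for t
      by (rule DERIV_nonneg_mono[where f = slope and f' = Y])
         (use that \<nu> in \<open>auto intro!: y_deriv' Y_nonneg\<close>)
    with t0 show ?thesis
      unfolding chi0 by (intro exI[of _ t0]) (force simp: slope_def)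
  qed
  then obtain t0 where t0: "0 < t0" "\<And>t. 0 < t \<Longrightarrow> t < t0 \<Longrightarrow> t * ratio (chi + t\<^sup>2) < norm \<gamma>"
    by blast
  define e where "e = \<gamma> /\<^sub>R norm \<gamma>"
  have e: "norm e = 1" "e \<bullet> \<gamma> = norm \<gamma>"
    using \<gamma>0 by (auto simp: e_def power2_norm_eq_inner[symmetric] power2_eq_square)
  define F where "F t = (e \<bullet> \<gamma>) * t + ln (gig_int a \<nu> (chi + t\<^sup>2))" for t
  have hF: "h chi (t *\<^sub>R e) = ennreal (exp (ln C + F t))" if "0 < t" for t
    using h_eq[OF ray_pos[OF chi e(1) that]] L_ray[OF e(1), of chi t] by (simp add: F_def)
  have mono: "F s \<le> F t" if st: "0 < s" "s \<le> t" "t < t0" for s t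
  proof (rule DERIV_nonneg_mono[where f = F and f' = "\<lambda>x. e \<bullet> \<gamma> - x * ratio (chi + x\<^sup>2)", OF st(2)])
    fix x assume "s \<le> x" "x \<le> t"
    with st have x: "0 < x" "x < t0" by auto
    show "(F has_real_derivative e \<bullet> \<gamma> - x * ratio (chi + x\<^sup>2)) (at x)"
      unfolding F_def[abs_def] by (rule ray_deriv) (use x chi in \<open>simp add: add_nonneg_pos\<close>)
    show "0 \<le> e \<bullet> \<gamma> - x * ratio (chi + x\<^sup>2)" using t0(2)[OF x] e by simp
  qed
  have "h chi 0 \<le> h chi ((t0 / 2) *\<^sub>R e)"
  proof (rule LIMSEQ_le_const2[OF h_ray_tendsto[OF e(1)]])
    obtain N where N: "\<And>n. n \<ge> N \<Longrightarrow> sqrt (1 / real (Suc n)) < t0 / 2"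
      using ray_seq_small[of "t0 / 2"] t0 by auto
    have "h chi (sqrt (1 / real (Suc n)) *\<^sub>R e) \<le> h chi ((t0 / 2) *\<^sub>R e)" if "n \<ge> N" for n
    proof -
      have "0 < sqrt (1 / real (Suc n))" by simp
      from hF[OF this] mono[OF this less_imp_le[OF N[OF that]]] show ?thesis
        using hF[of "t0 / 2"] t0 by (simp add: ennreal_leI)
    qed
    then show "\<exists>N. \<forall>n\<ge>N. h chi (sqrt (1 / real (Suc n)) *\<^sub>R e) \<le> h chi ((t0 / 2) *\<^sub>R e)" by blast
  qed
  moreover have "(t0 / 2) *\<^sub>R e \<noteq> 0" using e t0 by auto
  ultimately show ?thesis by blast
qed

end

section \<open>Reduction of the mixture density to \<open>h\<close>\<close>

lemma gig_params_cases:
  assumes "gig_params lam chi psi"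
  shows "0 \<le> chi" "0 \<le> psi" "chi = 0 \<Longrightarrow> 0 < lam" "psi = 0 \<Longrightarrow> lam < 0" "0 < lam \<Longrightarrow> 0 < psi"
  using assms by (cases lam "0::real" rule: linorder_cases; simp add: gig_params_def)+

lemma gig_density_eq_kernel:
  assumes "gig_params lam chi psi"
  obtains C where "0 < C" "\<And>x. 0 < x \<Longrightarrow> gig_density lam chi psi x = C * gig_kernel psi lam chi x"
proof -
  note p = gig_params_cases[OF assms]
  consider "chi = 0" | "chi \<noteq> 0" "psi = 0" | "chi \<noteq> 0" "psi \<noteq> 0" by blast
  then show thesis
  proof cases
    case 1
    then show thesis
      using p Gamma_real_pos[of lam]
      by (intro that[of "(psi / 2) powr lam / Gamma lam"]) (auto simp: gig_density_def gig_kernel_def)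
  next
    case 2
    then show thesis
      using p Gamma_real_pos[of "- lam"]
      by (intro that[of "(chi / 2) powr (- lam) / Gamma (- lam)"])
         (auto simp: gig_density_def gig_kernel_def mult.commute)
  next
    case 3
    then have "0 < Bessel_K lam (sqrt (psi * chi))" using p by (intro Bessel_K_pos) simp
    with 3 show thesis
      using p
      by (intro that[of "(psi / chi) powr (lam / 2) / (2 * Bessel_K lam (sqrt (psi * chi)))"])
         (auto simp: gig_density_def gig_kernel_def)
  qed
qed

text \<open>Expanding the square in the normal exponent separates terms in 1/x, constant and linear
  in x. They shift \<open>chi\<close> and \<open>psi\<close> and leave a factor exp(u \<bullet>
  \<gamma>), while \<open>(2 * pi * x) powr (- q)\<close> lowers the order by half the
  dimension.\<close>

lemma normal_mixture_density_gig:
  fixes \<mu> \<beta> :: "real ^ 'p" and A :: "real ^ 'p ^ 'p"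
  assumes inv: "invertible A" and params: "gig_params lam chi psi"
  defines "\<gamma> \<equiv> matrix_inv A *v \<beta>"
  obtains C where "0 < C"
    "\<And>y. normal_mixture_density \<mu> \<beta> A (gig_density lam chi psi) y
      = ennreal (C * exp ((matrix_inv A *v (y - \<mu>)) \<bullet> \<gamma>))
        * gig_nn (psi + (norm \<gamma>)\<^sup>2) (lam - real CARD('p) / 2) (chi + (norm (matrix_inv A *v (y - \<mu>)))\<^sup>2)"
proof -
  obtain C0 where C0: "0 < C0" "\<And>x. 0 < x \<Longrightarrow> gig_density lam chi psi x = C0 * gig_kernel psi lam chi x"
    using gig_density_eq_kernel[OF params] by blast
  define q where "q = real CARD('p) / 2"
  define C where "C = (2 * pi) powr (- q) * inverse \<bar>det A\<bar> * C0"
  have "det A \<noteq> 0" using inv by (simp add: invertible_det_nz)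
  then have C: "0 < C" using C0 by (simp add: C_def)
  show thesis
  proof (rule that[OF C])
    fix y
    define u where "u = matrix_inv A *v (y - \<mu>)"
    have v: "matrix_inv A *v (y - \<mu> - x *\<^sub>R \<beta>) = u - x *\<^sub>R \<gamma>" for x
      by (simp add: u_def \<gamma>_def matrix_vector_mult_diff_distrib matrix_vector_mult_scaleR)
    have eq: "(2 * pi * x) powr (- q) * inverse \<bar>det A\<bar> * exp (- ((norm (u - x *\<^sub>R \<gamma>))\<^sup>2 / (2 * x))) * gig_density lam chi psi x
        = C * exp (u \<bullet> \<gamma>) * gig_kernel (psi + (norm \<gamma>)\<^sup>2) (lam - q) (chi + (norm u)\<^sup>2) x"
      (is "?l x = ?r x") if x: "0 < x" for x
    proof -
      have n: "(norm (u - x *\<^sub>R \<gamma>))\<^sup>2 = (norm u)\<^sup>2 - 2 * x * (u \<bullet> \<gamma>) + x\<^sup>2 * (norm \<gamma>)\<^sup>2"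
        unfolding power2_norm_eq_inner
        by (simp add: inner_diff_left inner_diff_right inner_commute power2_eq_square)
      have e: "- ((norm (u - x *\<^sub>R \<gamma>))\<^sup>2 / (2 * x)) + - (chi / x + psi * x) / 2
          = u \<bullet> \<gamma> + - ((chi + (norm u)\<^sup>2) / x + (psi + (norm \<gamma>)\<^sup>2) * x) / 2"
        unfolding n using x by (simp add: field_simps power2_eq_square)
      have p: "(2 * pi * x) powr (- q) * x powr (lam - 1) = (2 * pi) powr (- q) * x powr (lam - q - 1)"
        using x by (simp add: powr_mult powr_add[symmetric] algebra_simps)
      have "(2 * pi * x) powr (- q) * inverse \<bar>det A\<bar> * exp (- ((norm (u - x *\<^sub>R \<gamma>))\<^sup>2 / (2 * x))) * gig_density lam chi psi x
          = inverse \<bar>det A\<bar> * C0 * ((2 * pi * x) powr (- q) * x powr (lam - 1))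
            * exp (- ((norm (u - x *\<^sub>R \<gamma>))\<^sup>2 / (2 * x)) + - (chi / x + psi * x) / 2)"
        unfolding C0(2)[OF x] gig_kernel_def exp_add by (simp only: mult_ac)
      also have "\<dots> = C * exp (u \<bullet> \<gamma>) * gig_kernel (psi + (norm \<gamma>)\<^sup>2) (lam - q) (chi + (norm u)\<^sup>2) x"
        unfolding e p exp_add gig_kernel_def C_def by (simp only: mult_ac)
      finally show ?thesis .
    qed
    have "ennreal (?l x) * indicator {0<..} x = ennreal (C * exp (u \<bullet> \<gamma>))
        * (ennreal (gig_kernel (psi + (norm \<gamma>)\<^sup>2) (lam - q) (chi + (norm u)\<^sup>2) x) * indicator {0<..} x)" for x
    proof (cases "0 < x")
      case True
      have "0 \<le> C * exp (u \<bullet> \<gamma>)" using C by simp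
      with True show ?thesis by (simp add: eq[OF True] ennreal_mult')
    qed simp
    then have "normal_mixture_density \<mu> \<beta> A (gig_density lam chi psi) y
        = (\<integral>\<^sup>+x. ennreal (C * exp (u \<bullet> \<gamma>)) * (ennreal (gig_kernel (psi + (norm \<gamma>)\<^sup>2) (lam - q) (chi + (norm u)\<^sup>2) x) * indicator {0<..} x) \<partial>lborel)"
      unfolding normal_mixture_density_def v q_def[symmetric] by simp
    also have "\<dots> = ennreal (C * exp (u \<bullet> \<gamma>)) * gig_nn (psi + (norm \<gamma>)\<^sup>2) (lam - q) (chi + (norm u)\<^sup>2)"
      unfolding gig_nn_def by (rule nn_integral_cmult) measurable
    finally show "normal_mixture_density \<mu> \<beta> A (gig_density lam chi psi) y
      = ennreal (C * exp ((matrix_inv A *v (y - \<mu>)) \<bullet> \<gamma>))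
        * gig_nn (psi + (norm \<gamma>)\<^sup>2) (lam - real CARD('p) / 2) (chi + (norm (matrix_inv A *v (y - \<mu>)))\<^sup>2)"
      by (simp add: u_def q_def)
  qed
qed

lemma is_mode_iff: "is_mode f m \<longleftrightarrow> (\<forall>z. z \<noteq> m \<longrightarrow> f z < f m)" for f :: "'a \<Rightarrow> ennreal"
proof
  assume mode: "is_mode f m"
  then have le: "f z \<le> f m" for z unfolding is_mode_def by auto
  show "\<forall>z. z \<noteq> m \<longrightarrow> f z < f m"
  proof (intro allI impI)
    fix z assume "z \<noteq> m"
    show "f z < f m"
    proof (rule ccontr)
      assume "\<not> f z < f m"
      then have "f x \<le> f z" for x using le[of x] by simp
      then have "z \<in> {y. \<forall>x. f x \<le> f y}" by simp
      with mode \<open>z \<noteq> m\<close> show False unfolding is_mode_def by auto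
    qed
  qed
next
  assume *: "\<forall>z. z \<noteq> m \<longrightarrow> f z < f m"
  then have "f z \<le> f m" for z by (cases "z = m") (auto intro: less_imp_le)
  moreover have "y = m" if "\<forall>z. f z \<le> f y" for y using * that by (meson not_less)
  ultimately show "is_mode f m" unfolding is_mode_def by auto
qed

theorem corollary2:
  fixes \<mu> \<beta> :: "real ^ 'p" and A :: "real ^ 'p ^ 'p" and lam chi psi :: real
    and f :: "real ^ 'p \<Rightarrow> ennreal"
  defines "f \<equiv> normal_mixture_density \<mu> \<beta> A (gig_density lam chi psi)"
  assumes full_rank: "rank A = CARD('p)"
    and params: "gig_params lam chi psi"
  shows "convex_contours f
    \<and> (is_mode f \<mu> \<longleftrightarrow>
         \<beta> = 0 \<or> (chi = 0 \<and> 0 < lam \<and> lam \<le> (real CARD('p) + 1) / 2))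
    \<and> (log_concave_fun f \<longleftrightarrow> lam \<ge> (real CARD('p) + 1) / 2)
    \<and> ((\<forall>b. b \<noteq> 0 \<longrightarrow> log_convex_fun_on {0<..} (\<lambda>t. f (\<mu> + t *\<^sub>R b))) \<longleftrightarrow>
         chi = 0 \<and> 0 < lam \<and> lam \<le> (real CARD('p) + 1) / 2)"
proof -
  have inv: "invertible A"
    using full_rank by (metis full_rank_injective invertible_left_inverse matrix_left_invertible_injective)
  note par = gig_params_cases[OF params]
  define \<gamma> where "\<gamma> = matrix_inv A *v \<beta>"
  define w where "w y = matrix_inv A *v (y - \<mu>)" for y
  define \<nu> where "\<nu> = lam - real CARD('p) / 2"
  define a where "a = psi + (norm \<gamma>)\<^sup>2"
  have \<nu>_ge: "1 / 2 \<le> \<nu> \<longleftrightarrow> (real CARD('p) + 1) / 2 \<le> lam"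
    and \<nu>_le: "\<nu> \<le> 1 / 2 \<longleftrightarrow> lam \<le> (real CARD('p) + 1) / 2"
    by (auto simp: \<nu>_def field_simps)
  obtain C where C: "0 < C" and f: "\<And>y. f y = ennreal (C * exp (w y \<bullet> \<gamma>)) * gig_nn a \<nu> (chi + (norm (w y))\<^sup>2)"
    unfolding f_def w_def \<gamma>_def a_def \<nu>_def
    using normal_mixture_density_gig[OF inv params, of \<mu> \<beta>] by blast
  interpret gig_mixture a \<nu> C \<gamma>
  proof
    show "0 \<le> a" "(norm \<gamma>)\<^sup>2 \<le> a" using par by (auto simp: a_def)
    show "0 < a \<or> \<nu> < 0"
    proof (cases "psi = 0")
      case True
      then show ?thesis using par(4) by (simp add: \<nu>_def)
    next
      case False
      then show ?thesis using par(2) by (simp add: a_def add_pos_nonneg)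
    qed
  qed (rule C)
  have fh: "f y = h chi (w y)" for y by (simp add: f h_def)
  have Aw: "A *v (matrix_inv A *v v) = v" "matrix_inv A *v (A *v v) = v" for v
    using matrix_inv_mult[OF inv] by (simp_all add: matrix_vector_mul_assoc)
  have w_surj: "w (\<mu> + A *v u) = u" for u by (simp add: w_def Aw)
  have w_inj: "w y = 0 \<longleftrightarrow> y = \<mu>" for y
    unfolding w_def by (metis Aw(1) diff_self eq_iff_diff_eq_0 matrix_vector_mult_0_right)
  \<comment> \<open>The change of variable is an affine bijection sending \<open>\<mu>\<close> to 0,
    so convexity, log-concavity and the mode transfer between \<open>f\<close> and
    \<open>h chi\<close>.\<close>
  have w_affine: "w (s *\<^sub>R x + t *\<^sub>R y) = s *\<^sub>R w x + t *\<^sub>R w y" if "s + t = 1" for s t x y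
  proof -
    have "s *\<^sub>R x + t *\<^sub>R y - \<mu> = s *\<^sub>R (x - \<mu>) + t *\<^sub>R (y - \<mu>)"
      using that by (simp add: algebra_simps) (metis scaleR_add_left scaleR_one)
    then show ?thesis
      by (simp add: w_def matrix_vector_right_distrib matrix_vector_mult_scaleR)
  qed
  have w_ray: "w (\<mu> + t *\<^sub>R b) = t *\<^sub>R (matrix_inv A *v b)" for t b
    by (simp add: w_def matrix_vector_mult_scaleR)
  have h_f: "h chi u = f (\<mu> + A *v u)" for u by (simp add: fh w_surj)
  have affine': "\<mu> + A *v (s *\<^sub>R x + t *\<^sub>R y) = s *\<^sub>R (\<mu> + A *v x) + t *\<^sub>R (\<mu> + A *v y)" if "s + t = 1" for s t x y
    using that by (simp add: matrix_vector_right_distrib matrix_vector_mult_scaleR algebra_simps)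
      (metis scaleR_add_left scaleR_one)
  obtain e :: "real ^ 'p" where e: "norm e = 1" by (meson norm_axis_1)

  have i: "convex_contours f"
    unfolding convex_contours_def
  proof
    fix c
    have "convex {u. ennreal c \<le> h chi u}"
      using h_convex_contours[OF par(1)] by (simp add: convex_contours_def)
    then show "convex {y. ennreal c \<le> f y}"
      by (simp add: convex_def fh w_affine)
  qed

  have mode: "is_mode f \<mu> \<longleftrightarrow> (\<forall>u. u \<noteq> 0 \<longrightarrow> h chi u < h chi 0)"
  proof -
    have "f \<mu> = h chi 0" by (simp add: fh w_def)
    then show ?thesis
      unfolding is_mode_iff by (metis fh w_inj w_surj)
  qed
  have \<gamma>0: "\<gamma> = 0 \<longleftrightarrow> \<beta> = 0"
    unfolding \<gamma>_def by (metis Aw(1) matrix_vector_mult_0_right)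
  have ii: "is_mode f \<mu> \<longleftrightarrow> \<beta> = 0 \<or> (chi = 0 \<and> 0 < lam \<and> lam \<le> (real CARD('p) + 1) / 2)"
  proof
    assume m: "is_mode f \<mu>"
    show "\<beta> = 0 \<or> (chi = 0 \<and> 0 < lam \<and> lam \<le> (real CARD('p) + 1) / 2)"
    proof (rule ccontr)
      assume *: "\<not> ?thesis"
      \<comment> \<open>If \<open>chi = 0\<close>, the parameter conditions force
        \<open>lam > 0\<close>, so only the upper bound on \<open>lam\<close> can fail.\<close>
      then have "0 < chi \<or> 1 / 2 < \<nu>"
        using par \<nu>_le by (cases "chi = 0") auto
      then obtain u where "u \<noteq> 0" "h chi 0 \<le> h chi u"
        using h_not_max_at_0[OF par(1)] * \<gamma>0 by blast
      with m show False unfolding mode by (auto simp: not_le[symmetric])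
    qed
  next
    assume *: "\<beta> = 0 \<or> (chi = 0 \<and> 0 < lam \<and> lam \<le> (real CARD('p) + 1) / 2)"
    have "norm \<gamma> < t * ratio (chi + t\<^sup>2)" if t: "0 < t" for t
    proof (cases "\<beta> = 0")
      case True
      then show ?thesis
        using t \<gamma>0 ratio_pos[of "chi + t\<^sup>2"] par(1) by (simp add: add_nonneg_pos)
    next
      case False
      with * have chi: "chi = 0" and lam: "0 < lam" and \<nu>: "\<nu> \<le> 1 / 2" using \<nu>_le by auto
      \<comment> \<open>Strict because \<open>lam > 0\<close> forces \<open>psi > 0\<close>.\<close>
      have "norm \<gamma> < sqrt a" using par(5)[OF lam] by (intro real_less_rsqrt) (simp add: a_def)
      also have "\<dots> \<le> t * ratio (chi + t\<^sup>2)" using slope_ge_sqrt[OF \<nu> t] chi by (simp add: slope_def)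
      finally show ?thesis .
    qed
    then show "is_mode f \<mu>" unfolding mode using h_max_at_0[OF par(1)] by blast
  qed

  have lc: "log_concave_fun f \<longleftrightarrow> log_concave_fun (h chi)"
    unfolding log_concave_fun_def
  proof (intro iffI allI ballI)
    fix x y :: "real ^ 'p" and \<theta> :: real
    assume \<theta>: "\<theta> \<in> {0<..<1}"
    {
      assume "\<forall>x y. \<forall>\<theta>\<in>{0<..<1}. epowr (f x) \<theta> * epowr (f y) (1 - \<theta>) \<le> f (\<theta> *\<^sub>R x + (1 - \<theta>) *\<^sub>R y)"
      then show "epowr (h chi x) \<theta> * epowr (h chi y) (1 - \<theta>) \<le> h chi (\<theta> *\<^sub>R x + (1 - \<theta>) *\<^sub>R y)"
        using \<theta> unfolding h_f by (subst affine') auto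
    next
      assume "\<forall>x y. \<forall>\<theta>\<in>{0<..<1}. epowr (h chi x) \<theta> * epowr (h chi y) (1 - \<theta>) \<le> h chi (\<theta> *\<^sub>R x + (1 - \<theta>) *\<^sub>R y)"
      then show "epowr (f x) \<theta> * epowr (f y) (1 - \<theta>) \<le> f (\<theta> *\<^sub>R x + (1 - \<theta>) *\<^sub>R y)"
        using \<theta> unfolding fh by (subst w_affine) auto
    }
  qed
  have iii: "log_concave_fun f \<longleftrightarrow> lam \<ge> (real CARD('p) + 1) / 2"
    unfolding lc \<nu>_ge[symmetric]
    using h_log_concave[OF _ par(1)] h_not_log_concave[OF _ par(1) e] by (meson not_le)

  have iv: "(\<forall>b. b \<noteq> 0 \<longrightarrow> log_convex_fun_on {0<..} (\<lambda>t. f (\<mu> + t *\<^sub>R b))) \<longleftrightarrow>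
      chi = 0 \<and> 0 < lam \<and> lam \<le> (real CARD('p) + 1) / 2"
  proof
    assume *: "\<forall>b. b \<noteq> 0 \<longrightarrow> log_convex_fun_on {0<..} (\<lambda>t. f (\<mu> + t *\<^sub>R b))"
    \<comment> \<open>A single direction suffices here: it corresponds to the unit vector
      \<open>e\<close> in the coordinate \<open>u\<close>.\<close>
    have "A *v e \<noteq> 0" using e Aw(2)[of e] by auto
    with * have "log_convex_fun_on {0<..} (\<lambda>t. f (\<mu> + t *\<^sub>R (A *v e)))" by blast
    then have "log_convex_fun_on {0<..} (\<lambda>t. h chi (t *\<^sub>R e))" by (simp add: fh w_ray Aw)
    from h_log_convex_ray_imp[OF par(1) e this] show "chi = 0 \<and> 0 < lam \<and> lam \<le> (real CARD('p) + 1) / 2"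
      using par(3) \<nu>_le by simp
  next
    assume *: "chi = 0 \<and> 0 < lam \<and> lam \<le> (real CARD('p) + 1) / 2"
    show "\<forall>b. b \<noteq> 0 \<longrightarrow> log_convex_fun_on {0<..} (\<lambda>t. f (\<mu> + t *\<^sub>R b))"
    proof (intro allI impI)
      fix b :: "real ^ 'p" assume "b \<noteq> 0"
      then have "matrix_inv A *v b \<noteq> 0" using Aw(1)[of b] by auto
      then show "log_convex_fun_on {0<..} (\<lambda>t. f (\<mu> + t *\<^sub>R b))"
        using h_log_convex_ray[of "matrix_inv A *v b"] * \<nu>_le by (simp add: fh w_ray)
    qed
  qed
  show ?thesis using i ii iii iv by blast
qed

end
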